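(* Let $r,c$ be positive integers, $\rho>0$, and let $\pi^{(1)}_\star\in\mathbb{R}^r_{>0}$, $\pi^{(2)}_\star\in\mathbb{R}^c_{>0}$ be probability vectors. For each $n$, let $(U_\ell,V_\ell)_{\ell=1}^n$ be i.i.d. pairs with $U_\ell\sim\mathrm{Multinomial}(1,\pi_\star^{(1)})$ and $V_\ell\sim\mathrm{Multinomial}(1,\pi_\star^{(2)})$, let $H$ be the $r\times c$ contingency table $H_{i,j}=\sum_{\ell=1}^n\mathbf{1}\{U_{\ell,i}=1,\ V_{\ell,j}=1\}$, and let $Z\sim N(\mathbf{0},\frac n\rho I_{rc})$ be independent of the data, indexed by $(i,j)\in[r]\times[c]$. Let $\hat n=n+\sum_{i,j}Z_{i,j}$, $$\hat\pi^{(1)}=\left(\tfrac1{\hat n}\textstyle\sum_{j}(H_{i,j}+Z_{i,j}):i\in[r]\right),\qquad \hat\pi^{(2)}=\left(\tfrac1{\hat n}\textstyle\sum_{i}(H_{i,j}+Z_{i,j}):j\in[c]\right),$$ $$\hat M=\mathrm{Diag}\big(p(\hat\pi^{(1)},\hat\pi^{(2)})\big)-p(\hat\pi^{(1)},\hat\pi^{(2)})\,p(\hat\pi^{(1)},\hat\pi^{(2)})^\top+\tfrac1\rho I_{rc},$$ and for probability vectors $\pi^{(1)}\in\mathbb{R}^r_{>0}$, $\pi^{(2)}\in\mathbb{R}^c_{>0}$, $$\hat T^{(n)}(\pi^{(1)},\pi^{(2)})=\frac1n\left(H+Z-n\,p(\pi^{(1)},\pi^{(2)})\right)^\top\Pi\,\hat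 M^{-1}\,\Pi\left(H+Z-n\,p(\pi^{(1)},\pi^{(2)})\right).$$ If $U$ and $V$ are independent (i.e. $U_\ell$ and $V_\ell$ are independent for each $\ell$), then as $n\to\infty$, $$\min_{\pi^{(1)},\pi^{(2)}}\hat T^{(n)}(\pi^{(1)},\pi^{(2)})\xrightarrow{D}\chi^2_{(r-1)(c-1)},$$ the minimum being over probability vectors $\pi^{(1)}\in\mathbb{R}^r_{>0}$ and $\pi^{(2)}\in\mathbb{R}^c_{>0}$.
   Context: $r\times c$ tables are identified with vectors in $\mathbb{R}^{rc}$. For vectors $a\in\mathbb{R}^r,b\in\mathbb{R}^c$, $p(a,b)=ab^\top$, flattened to a vector in $\mathbb{R}^{rc}$. $\Pi=I_{rc}-\frac1{rc}\mathbf{1}\mathbf{1}^\top$ with $\mathbf{1}$ the all-ones vector. A $\mathrm{Multinomial}(1,\pi)$ variable is the standard basis vector $e_j$ with probability $\pi_j$. $\chi^2_\nu$ is the chi-square distribution with $\nu$ degrees of freedom; $\xrightarrow{D}$ is convergence in distribution. The minimum is read as an infimum if it is not attained, and the statistic may be given any fixed value on the event where $\hat n=0$ or $\hat M$ is singular. *)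

theory Defs
  imports "HOL-Probability.Probability"
begin

(* The library's indep_var forces both random variables to have the same codomain type. *)
definition independent_rvs ::
    "'a measure \<Rightarrow> 'b measure \<Rightarrow> ('a \<Rightarrow> 'b) \<Rightarrow> 'c measure \<Rightarrow> ('a \<Rightarrow> 'c) \<Rightarrow> bool" where
  "independent_rvs M S X T Y \<longleftrightarrow>
     X \<in> measurable M S \<and> Y \<in> measurable M T \<and>
     prob_space.indep_set M {X -` A \<inter> space M | A. A \<in> sets S} {Y -` B \<inter> space M | B. B \<in> sets T}"

definition positive_prob_vectors :: "(real^'n) set" where
  "positive_prob_vectors = {p. (\<forall>i. p $ i > 0) \<and> (\<Sum>i\<in>UNIV. p $ i) = 1}"

(* The condition determines the law of X: the listed probabilities sum to 1. *)
definition multinomial1_distributed :: "'a measure \<Rightarrow> ('a \<Rightarrow> real^'n) \<Rightarrow> real^'n \<Rightarrow> bool" where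
  "multinomial1_distributed M X p \<longleftrightarrow>
     X \<in> borel_measurable M \<and>
     (\<forall>j. measure M {\<omega> \<in> space M. X \<omega> = axis j 1} = p $ j)"

(* The density of N(mu, Sigma); meaningful for symmetric positive definite Sigma only. *)
definition multivariate_normal_density :: "real^'n \<Rightarrow> real^'n^'n \<Rightarrow> real^'n \<Rightarrow> real" where
  "multivariate_normal_density \<mu> \<Sigma> x =
     exp (- ((x - \<mu>) \<bullet> (matrix_inv \<Sigma> *v (x - \<mu>))) / 2) / sqrt ((2 * pi) ^ CARD('n) * det \<Sigma>)"

(* The law of a sum of squares of k independent standard normals; for k = 0 it is the
   point mass at 0. *)
definition chi_square_distribution :: "nat \<Rightarrow> real measure" where
  "chi_square_distribution k =
     distr (\<Pi>\<^sub>M i\<in>{..<k}. std_normal_distribution) borel (\<lambda>x. \<Sum>i<k. (x i)\<^sup>2)"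

definition diag_matrix :: "real^'n \<Rightarrow> real^'n^'n" where
  "diag_matrix v = (\<chi> i j. if i = j then v $ i else 0)"

definition outer_product :: "real^'n \<Rightarrow> real^'n \<Rightarrow> real^'n^'n" where
  "outer_product v w = (\<chi> i j. v $ i * w $ j)"

definition centering_matrix :: "real^'n^'n" where
  "centering_matrix = mat 1 - (1 / real CARD('n)) *\<^sub>R outer_product 1 1"

(* Tables are flattened by using the product type of the row and column indices as the
   index type of a vector. *)
definition product_table :: "real^'r \<Rightarrow> real^'c \<Rightarrow> real^('r::finite \<times> 'c::finite)" where
  "product_table a b = (\<chi> k. a $ fst k * b $ snd k)"

definition contingency_table ::
    "nat \<Rightarrow> (nat \<Rightarrow> real^'r) \<Rightarrow> (nat \<Rightarrow> real^'c) \<Rightarrow> real^('r::finite \<times> 'c::finite)" where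
  "contingency_table n u v =
     (\<chi> k. \<Sum>l=1..n. of_bool (u l $ fst k = 1 \<and> v l $ snd k = 1))"

(* In the following, h is the table of counts and z the noise table. *)

definition noisy_size :: "nat \<Rightarrow> real^('r::finite \<times> 'c::finite) \<Rightarrow> real" where
  "noisy_size n z = real n + (\<Sum>k\<in>UNIV. z $ k)"

definition row_estimate ::
    "nat \<Rightarrow> real^('r::finite \<times> 'c::finite) \<Rightarrow> real^('r::finite \<times> 'c::finite) \<Rightarrow> real^'r" where
  "row_estimate n h z = (\<chi> i. 1 / noisy_size n z * (\<Sum>j\<in>UNIV. h $ (i, j) + z $ (i, j)))"

definition column_estimate ::
    "nat \<Rightarrow> real^('r::finite \<times> 'c::finite) \<Rightarrow> real^('r::finite \<times> 'c::finite) \<Rightarrow> real^'c" where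
  "column_estimate n h z = (\<chi> j. 1 / noisy_size n z * (\<Sum>i\<in>UNIV. h $ (i, j) + z $ (i, j)))"

definition covariance_estimate ::
    "real \<Rightarrow> nat \<Rightarrow> real^('r::finite \<times> 'c::finite) \<Rightarrow> real^('r::finite \<times> 'c::finite) \<Rightarrow> real^('r::finite \<times> 'c::finite)
      ^('r::finite \<times> 'c::finite)" where
  "covariance_estimate \<rho> n h z =
     (let p = product_table (row_estimate n h z) (column_estimate n h z)
      in diag_matrix p - outer_product p p + (1 / \<rho>) *\<^sub>R mat 1)"

definition private_statistic ::
    "real \<Rightarrow> nat \<Rightarrow> real^('r::finite \<times> 'c::finite) \<Rightarrow> real^('r::finite \<times> 'c::finite) \<Rightarrow> real^'r \<Rightarrow> real^'c \<Rightarrow> real" where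
  "private_statistic \<rho> n h z a b =
     (let x = h + z - real n *\<^sub>R product_table a b
      in 1 / real n *
         (x \<bullet> ((centering_matrix ** matrix_inv (covariance_estimate \<rho> n h z) ** centering_matrix) *v x)))"

(* The parameter d is the value on the exceptional event. The infimum is over a nonempty set
   on which the statistic is bounded, so Inf on the reals is the genuine infimum. *)
definition min_private_statistic ::
    "real \<Rightarrow> real \<Rightarrow> nat \<Rightarrow> real^('r::finite \<times> 'c::finite) \<Rightarrow> real^('r::finite \<times> 'c::finite) \<Rightarrow> real" where
  "min_private_statistic d \<rho> n h z =
     (if noisy_size n z = 0 \<or> \<not> invertible (covariance_estimate \<rho> n h z) then d
      else (INF (a, b) \<in> positive_prob_vectors \<times> positive_prob_vectors.
              private_statistic \<rho> n h z a b))"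

end

theory Submission
  imports Defs
begin

text \<open>Write \<open>p\<close> for the product table of \<open>\<pi>1\<close> and \<open>\<pi>2\<close> and \<open>X\<^sub>n = (H + Z - n p) / sqrt n\<close>. Since the counts sum
  to \<open>n\<close>, the minimal statistic is almost surely \<open>F\<^sub>n(X\<^sub>n)\<close> for a deterministic function \<open>F\<^sub>n\<close>. The noise makes
  \<open>X\<^sub>n\<close> a Gaussian smoothing of \<open>W\<^sub>n = (H - n p) / sqrt n\<close> with fixed variance \<open>1 / \<rho>\<close>; its density is an integral of
  the characteristic function of \<open>W\<^sub>n\<close> against a Gaussian, so convergence of characteristic functions gives
  pointwise convergence of densities and, by Scheffe's lemma, convergence of the laws in total variation.
  Hence no tightness or uniformity is needed: it suffices that \<open>F\<^sub>n(x)\<close> converges for every fixed \<open>x\<close>. Its limit is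
  the squared distance, in the inner product given by the inverse limit covariance, from \<open>x\<close> to the span of the
  tangent space at \<open>p\<close> of the independence model and the constant tables. That span has dimension \<open>r + c - 1\<close>,
  which leaves \<open>(r - 1) (c - 1)\<close> degrees of freedom.\<close>

text \<open>The counts are discrete and the Gaussian limit of \<open>W\<^sub>n\<close> has the
  singular covariance \<open>diag p - p p\<^sup>T\<close>, while the estimated covariance and the
  minimiser change with n. Weak convergence of \<open>X\<^sub>n\<close> alone would call for a
  mapping theorem along a sequence of functions. Total variation avoids it: P(F_n(X_n) \<le> c) may
  be replaced by P(F_n(X) \<le> c) with X the limit vector, although the event itself depends on n,
  and what is left is dominated convergence under one fixed law. The projection
  \<open>centering_matrix\<close> does not spoil the chi-square limit because constant tables are
  eigenvectors of the limit covariance: the multinomial part annihilates them and the noise part is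
  a multiple of the identity. In the inner product of the inverse covariance they are therefore
  orthogonal to all tables of sum zero, so removing them costs exactly one dimension and leaves the
  remaining residual untouched.\<close>

section \<open>Standard Gaussian vectors\<close>

text \<open>The density is a product over the basis so that integrals split by coordinates;
  \<open>prod_std_normal_density\<close> supplies the radial form.\<close>

definition std_gaussian :: "'e::euclidean_space measure" where
  "std_gaussian = density lborel (\<lambda>x. ennreal (\<Prod>b\<in>Basis. std_normal_density (x \<bullet> b)))"

lemma sets_std_gaussian [simp, measurable_cong]: "sets std_gaussian = sets borel"
  by (simp add: std_gaussian_def)

lemma space_std_gaussian [simp]: "space std_gaussian = UNIV"
  by (simp add: std_gaussian_def)

lemma sum_Basis_inner_power2: "(\<Sum>b\<in>Basis. (x \<bullet> b)\<^sup>2) = (norm (x::'e::euclidean_space))\<^sup>2"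
  unfolding power2_norm_eq_inner by (subst euclidean_inner) (simp add: power2_eq_square)

lemma prod_std_normal_density:
  "(\<Prod>b\<in>Basis. std_normal_density ((x::'e::euclidean_space) \<bullet> b)) =
     exp (- (norm x)\<^sup>2 / 2) / sqrt (2 * pi) ^ DIM('e)"
proof -
  have "(\<Prod>b\<in>Basis. std_normal_density (x \<bullet> b)) =
      (\<Prod>b\<in>Basis. exp (- (x \<bullet> b)\<^sup>2 / 2)) / (\<Prod>b\<in>(Basis::'e set). sqrt (2 * pi))"
    by (simp add: std_normal_density_def prod_dividef del: prod_constant)
  also have "(\<Prod>b\<in>Basis. exp (- (x \<bullet> b)\<^sup>2 / 2)) = exp (\<Sum>b\<in>Basis. - (x \<bullet> b)\<^sup>2 / 2)"
    by (simp add: exp_sum)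
  also have "(\<Sum>b\<in>Basis. - (x \<bullet> b)\<^sup>2 / 2) = - (\<Sum>b\<in>Basis. (x \<bullet> b)\<^sup>2) / 2"
    by (simp add: sum_negf flip: sum_divide_distrib)
  finally show ?thesis by (simp add: sum_Basis_inner_power2)
qed

text \<open>Bridge to product measures: it yields total mass one, the factorisation of the
  characteristic function, and the link to the product space in
  \<open>chi_square_distribution\<close>.\<close>

lemma distr_std_gaussian_components:
  "distr std_gaussian (\<Pi>\<^sub>M b\<in>Basis. borel) (\<lambda>x::'e::euclidean_space. \<lambda>b\<in>Basis. x \<bullet> b) =
     (\<Pi>\<^sub>M b\<in>Basis. std_normal_distribution)"
proof -
  interpret prob_space std_normal_distribution
    using real_dist_normal_dist by (simp add: real_distribution_def)
  interpret product_sigma_finite "\<lambda>_::'e. std_normal_distribution"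
    by unfold_locales
  show ?thesis
  proof (rule PiM_eqI)
    fix A :: "'e \<Rightarrow> real set"
    assume A: "\<And>b. b \<in> Basis \<Longrightarrow> A b \<in> sets std_normal_distribution"
    have [measurable]: "\<And>b. b \<in> Basis \<Longrightarrow> A b \<in> sets borel"
      using A by simp
    have "emeasure (distr std_gaussian (\<Pi>\<^sub>M b\<in>Basis. borel) (\<lambda>x. \<lambda>b\<in>Basis. x \<bullet> b)) (Pi\<^sub>E Basis A)
        = emeasure std_gaussian {x. \<forall>b\<in>Basis. x \<bullet> b \<in> A b}"
      by (subst emeasure_distr) (auto intro!: arg_cong2 [where f = emeasure] sets_PiM_I_finite)
    also have "\<dots> = (\<integral>\<^sup>+x. (\<Prod>b\<in>Basis. ennreal (std_normal_density (x \<bullet> b)) * indicator (A b) (x \<bullet> b)) \<partial>lborel)"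
      unfolding std_gaussian_def
      by (subst emeasure_density)
         (auto intro!: nn_integral_cong simp: prod_ennreal prod.distrib indicator_def split: if_splits)
    also have "\<dots> = (\<Prod>b\<in>(Basis::'e set). \<integral>\<^sup>+x. ennreal (std_normal_density x) * indicator (A b) x \<partial>lborel)"
      by (rule nn_integral_lborel_prod) auto
    also have "\<dots> = (\<Prod>b\<in>Basis. emeasure std_normal_distribution (A b))"
      by (intro prod.cong refl) (simp add: emeasure_density)
    finally show "emeasure (distr std_gaussian (\<Pi>\<^sub>M b\<in>Basis. borel) (\<lambda>x. \<lambda>b\<in>Basis. x \<bullet> b)) (Pi\<^sub>E Basis A)
        = (\<Prod>b\<in>Basis. emeasure std_normal_distribution (A b))" .
  qed (auto intro!: sets_PiM_cong)
qed

interpretation std_gaussian: prob_space "std_gaussian :: 'e::euclidean_space measure"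
proof
  interpret prob_space std_normal_distribution
    using real_dist_normal_dist by (simp add: real_distribution_def)
  interpret product_prob_space "\<lambda>_::'e. std_normal_distribution" "Basis"
    by unfold_locales
  have "emeasure (std_gaussian :: 'e measure) UNIV =
      emeasure (distr std_gaussian (\<Pi>\<^sub>M b\<in>Basis. borel) (\<lambda>x::'e. \<lambda>b\<in>Basis. x \<bullet> b)) (space (\<Pi>\<^sub>M b\<in>(Basis::'e set). borel))"
    by (subst emeasure_distr) (auto simp: space_PiM intro!: arg_cong2 [where f = emeasure])
  also have "\<dots> = 1"
    using P.emeasure_space_1 unfolding distr_std_gaussian_components by (simp add: space_PiM)
  finally show "emeasure (std_gaussian :: 'e measure) (space std_gaussian) = 1" by simp
qed

lemma integrable_cis:
  assumes "prob_space N" "f \<in> borel_measurable N"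
  shows "integrable N (\<lambda>x. cis (f x))"
proof -
  interpret prob_space N by fact
  have "(\<lambda>x. cis (f x)) \<in> borel_measurable N"
    using assms(2) by (simp add: cis_conv_exp)
  then show ?thesis
    by (intro integrable_const_bound [where B = 1]) auto
qed

lemma char_std_gaussian:
  "(\<integral>x. cis (t \<bullet> x) \<partial>std_gaussian) = of_real (exp (- (norm (t::'e::euclidean_space))\<^sup>2 / 2))"
proof -
  have ps: "prob_space std_normal_distribution"
    using real_dist_normal_dist by (simp add: real_distribution_def)
  interpret prob_space std_normal_distribution by (rule ps)
  interpret product_sigma_finite "\<lambda>_::'e. std_normal_distribution"
    by unfold_locales
  \<comment> \<open>The restriction to \<open>Basis\<close> makes the integrand a function of the
    coordinate family, to which the product law applies.\<close>
  have "(\<integral>x. cis (t \<bullet> x) \<partial>std_gaussian) =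
      (\<integral>x. (\<Prod>b\<in>Basis. cis ((t \<bullet> b) * (\<lambda>b\<in>Basis. x \<bullet> b) b)) \<partial>std_gaussian)"
  proof (intro Bochner_Integration.integral_cong refl)
    fix x :: 'e
    have "(\<Prod>b\<in>Basis. cis ((t \<bullet> b) * (x \<bullet> b))) = cis (\<Sum>b\<in>Basis. (t \<bullet> b) * (x \<bullet> b))"
      by (simp add: cis_conv_exp exp_sum sum_distrib_left)
    then show "cis (t \<bullet> x) = (\<Prod>b\<in>Basis. cis ((t \<bullet> b) * (\<lambda>b\<in>Basis. x \<bullet> b) b))"
      by (simp add: euclidean_inner [of t x])
  qed
  also have "\<dots> = (\<integral>f. (\<Prod>b\<in>Basis. cis ((t \<bullet> b) * f b)) \<partial>distr std_gaussian (\<Pi>\<^sub>M b\<in>Basis. borel) (\<lambda>x::'e. \<lambda>b\<in>Basis. x \<bullet> b))"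
    by (subst integral_distr) (auto simp: cis_conv_exp)
  also have "\<dots> = (\<Prod>b\<in>(Basis::'e set). \<integral>x. cis ((t \<bullet> b) * x) \<partial>std_normal_distribution)"
    unfolding distr_std_gaussian_components
    by (rule product_integral_prod) (auto intro!: integrable_cis ps)
  also have "\<dots> = (\<Prod>b\<in>(Basis::'e set). of_real (exp (- (t \<bullet> b)\<^sup>2 / 2)))"
    using char_std_normal_distribution by (simp add: char_def cis_conv_exp fun_eq_iff)
  also have "\<dots> = of_real (exp (\<Sum>b\<in>(Basis::'e set). - (t \<bullet> b)\<^sup>2 / 2))"
    by (simp add: exp_sum)
  also have "(\<Sum>b\<in>Basis. - (t \<bullet> b)\<^sup>2 / 2) = - (\<Sum>b\<in>Basis. (t \<bullet> b)\<^sup>2) / 2"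
    by (simp add: sum_negf flip: sum_divide_distrib)
  finally show ?thesis by (simp add: sum_Basis_inner_power2)
qed

section \<open>Gaussian smoothing and total variation\<close>

definition gaussian_smoothing :: "real \<Rightarrow> 'e::euclidean_space measure \<Rightarrow> 'e measure" where
  "gaussian_smoothing s \<nu> = distr (\<nu> \<Otimes>\<^sub>M std_gaussian) borel (\<lambda>(w, g). w + s *\<^sub>R g)"

text \<open>For s > 0 the kernel is the density at \<open>x\<close> of
  \<open>N(w, s\<^sup>2 I)\<close>, averaged over the centre \<open>w\<close>.\<close>

definition smoothed_density :: "real \<Rightarrow> 'e::euclidean_space measure \<Rightarrow> 'e \<Rightarrow> real" where
  "smoothed_density s \<nu> x =
     (\<integral>w. exp (- (norm ((x - w) /\<^sub>R s))\<^sup>2 / 2) / (sqrt (2 * pi) * s) ^ DIM('e) \<partial>\<nu>)"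

text \<open>Substitute x = w + s g: the Jacobian cancels the power of \<open>s\<close> in the
  normalising constant. Besides the smoothing, the case w = 0 identifies the law of the noise
  table.\<close>

lemma emeasure_std_gaussian_affine:
  fixes w :: "'e::euclidean_space"
  assumes s: "s > 0" and A[measurable]: "A \<in> sets borel"
  shows "emeasure std_gaussian {g. w + s *\<^sub>R g \<in> A} =
    (\<integral>\<^sup>+x. ennreal (exp (- (norm ((x - w) /\<^sub>R s))\<^sup>2 / 2) / (sqrt (2 * pi) * s) ^ DIM('e)) * indicator A x \<partial>lborel)"
proof -
  have cancel: "inverse s * (s * r) = r" for r
    using s by simp
  have "(\<integral>\<^sup>+x. ennreal (exp (- (norm ((x - w) /\<^sub>R s))\<^sup>2 / 2) / (sqrt (2 * pi) * s) ^ DIM('e)) * indicator A x \<partial>lborel)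
     = (\<integral>\<^sup>+g. ennreal (\<bar>s\<bar> ^ DIM('e)) * (ennreal (exp (- (norm g)\<^sup>2 / 2) / (sqrt (2 * pi) * s) ^ DIM('e)) * indicator A (w + s *\<^sub>R g)) \<partial>lborel)"
    using s by (subst lborel_affine [of s w]) (simp_all add: cancel nn_integral_density nn_integral_distr)
  also have "\<dots> = (\<integral>\<^sup>+g. ennreal (exp (- (norm g)\<^sup>2 / 2) / sqrt (2 * pi) ^ DIM('e)) * indicator A (w + s *\<^sub>R g) \<partial>lborel)"
    using s by (intro nn_integral_cong) (simp add: power_mult_distrib mult.assoc [symmetric] flip: ennreal_mult)
  also have "\<dots> = (\<integral>\<^sup>+g. ennreal (\<Prod>b\<in>Basis. std_normal_density (g \<bullet> b)) * indicator {g. w + s *\<^sub>R g \<in> A} g \<partial>lborel)"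
    by (intro nn_integral_cong) (simp add: prod_std_normal_density indicator_def)
  also have "\<dots> = emeasure std_gaussian {g. w + s *\<^sub>R g \<in> A}"
    unfolding std_gaussian_def by (subst emeasure_density) auto
  finally show ?thesis ..
qed

lemma prob_space_gaussian_smoothing:
  assumes "prob_space \<nu>" and [measurable_cong]: "sets \<nu> = sets (borel :: 'e::euclidean_space measure)"
  shows "prob_space (gaussian_smoothing s \<nu>)"
proof -
  interpret prob_space \<nu> by fact
  interpret pair_prob_space \<nu> "std_gaussian :: 'e measure" by unfold_locales
  show ?thesis
    unfolding gaussian_smoothing_def by (intro P.prob_space_distr) measurable
qed

lemma smoothed_density_nonneg: "s > 0 \<Longrightarrow> smoothed_density s \<nu> x \<ge> 0"
  unfolding smoothed_density_def by (intro Bochner_Integration.integral_nonneg) auto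

lemma measurable_smoothed_density [measurable]:
  assumes "prob_space \<nu>" and [measurable_cong]: "sets \<nu> = sets (borel :: 'e::euclidean_space measure)"
  shows "smoothed_density s \<nu> \<in> borel_measurable borel"
proof -
  interpret prob_space \<nu> by fact
  show ?thesis
    unfolding smoothed_density_def[abs_def] by measurable
qed

text \<open>Condition on \<open>w\<close>, apply the affine formula to the Gaussian part and
  exchange the two nonnegative integrals. The density exists even when \<nu> is discrete or
  degenerate.\<close>

lemma emeasure_gaussian_smoothing:
  fixes \<nu> :: "'e::euclidean_space measure"
  assumes s: "s > 0" and \<nu>: "prob_space \<nu>" and sets_\<nu>[measurable_cong]: "sets \<nu> = sets borel"
    and A[measurable]: "A \<in> sets borel"
  shows "emeasure (gaussian_smoothing s \<nu>) A =
    (\<integral>\<^sup>+x. ennreal (smoothed_density s \<nu> x) * indicator A x \<partial>lborel)"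
proof -
  interpret prob_space \<nu> by fact
  interpret pair_sigma_finite \<nu> "lborel :: 'e measure" by unfold_locales
  define k where "k x w = exp (- (norm ((x - w) /\<^sub>R s))\<^sup>2 / 2) / (sqrt (2 * pi) * s) ^ DIM('e)" for x w :: 'e
  have k[measurable]: "(\<lambda>(x, w). k x w) \<in> borel_measurable (borel \<Otimes>\<^sub>M borel)"
    unfolding k_def by measurable
  have k_nonneg: "k x w \<ge> 0" for x w
    using s by (simp add: k_def)
  have sp[simp]: "space \<nu> = UNIV"
    using sets_eq_imp_space_eq[OF sets_\<nu>] by simp
  have "emeasure (gaussian_smoothing s \<nu>) A =
      emeasure (\<nu> \<Otimes>\<^sub>M std_gaussian) {p. fst p + s *\<^sub>R snd p \<in> A}"
    unfolding gaussian_smoothing_def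
    by (subst emeasure_distr) (auto simp: space_pair_measure split_beta intro!: arg_cong2 [where f = emeasure])
  also have "\<dots> = (\<integral>\<^sup>+w. emeasure std_gaussian {g. w + s *\<^sub>R g \<in> A} \<partial>\<nu>)"
  proof (subst std_gaussian.emeasure_pair_measure_alt)
    have "{p. fst p + s *\<^sub>R snd p \<in> A} \<inter> space (\<nu> \<Otimes>\<^sub>M std_gaussian) \<in> sets (\<nu> \<Otimes>\<^sub>M std_gaussian)"
      by measurable
    then show "{p. fst p + s *\<^sub>R snd p \<in> A} \<in> sets (\<nu> \<Otimes>\<^sub>M std_gaussian)"
      by (simp add: space_pair_measure)
  qed simp
  also have "\<dots> = (\<integral>\<^sup>+w. (\<integral>\<^sup>+x. ennreal (k x w) * indicator A x \<partial>lborel) \<partial>\<nu>)"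
    using s by (simp add: emeasure_std_gaussian_affine k_def)
  also have "\<dots> = (\<integral>\<^sup>+x. (\<integral>\<^sup>+w. ennreal (k x w) * indicator A x \<partial>\<nu>) \<partial>lborel)"
    by (rule Fubini' [symmetric]) measurable
  also have "\<dots> = (\<integral>\<^sup>+x. ennreal (smoothed_density s \<nu> x) * indicator A x \<partial>lborel)"
  proof (intro nn_integral_cong)
    fix x :: 'e
    have "k x w \<le> 1 / (sqrt (2 * pi) * s) ^ DIM('e)" for w
      using s by (simp add: k_def divide_right_mono)
    then have "integrable \<nu> (k x)"
      using s by (intro integrable_const_bound [where B = "1 / (sqrt (2 * pi) * s) ^ DIM('e)"]) (auto simp: k_def)
    then have "(\<integral>\<^sup>+w. ennreal (k x w) \<partial>\<nu>) = ennreal (smoothed_density s \<nu> x)"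
      using s unfolding smoothed_density_def k_def [symmetric]
      by (intro nn_integral_eq_integral) (auto intro!: AE_I2 simp: k_nonneg)
    then show "(\<integral>\<^sup>+w. ennreal (k x w) * indicator A x \<partial>\<nu>) = ennreal (smoothed_density s \<nu> x) * indicator A x"
      by (subst nn_integral_multc) auto
  qed
  finally show ?thesis .
qed

text \<open>The Gaussian kernel is, up to scaling, its own characteristic function; this replaces Fourier inversion.\<close>

lemma smoothed_density_eq_char:
  fixes \<nu> :: "'e::euclidean_space measure"
  assumes s: "s > 0" and \<nu>: "prob_space \<nu>" and sets_\<nu>[measurable_cong]: "sets \<nu> = sets borel"
  shows "complex_of_real (smoothed_density s \<nu> x) =
    (\<integral>t. cis (t \<bullet> x / s) * (\<integral>w. cis ((- (1 / s) *\<^sub>R t) \<bullet> w) \<partial>\<nu>) \<partial>std_gaussian)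
      / of_real ((sqrt (2 * pi) * s) ^ DIM('e))"
proof -
  interpret prob_space \<nu> by fact
  interpret pair_prob_space \<nu> "std_gaussian :: 'e measure" by unfold_locales
  define c where "c = (sqrt (2 * pi) * s) ^ DIM('e)"
  have "complex_of_real (smoothed_density s \<nu> x) =
      (\<integral>w. of_real (exp (- (norm ((x - w) /\<^sub>R s))\<^sup>2 / 2)) \<partial>\<nu>) / of_real c"
    by (simp add: smoothed_density_def c_def)
  also have "(\<integral>w. complex_of_real (exp (- (norm ((x - w) /\<^sub>R s))\<^sup>2 / 2)) \<partial>\<nu>) =
      (\<integral>w. (\<integral>t. cis (((x - w) /\<^sub>R s) \<bullet> t) \<partial>std_gaussian) \<partial>\<nu>)"
    by (simp only: char_std_gaussian)
  also have "\<dots> = (\<integral>t. (\<integral>w. cis (((x - w) /\<^sub>R s) \<bullet> t) \<partial>\<nu>) \<partial>std_gaussian)"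
    by (rule Fubini_integral [symmetric])
       (use integrable_cis [OF P.prob_space_axioms, of "\<lambda>(w, t). ((x - w) /\<^sub>R s) \<bullet> t"] in \<open>simp add: split_beta'\<close>)
  also have "\<dots> = (\<integral>t. cis (t \<bullet> x / s) * (\<integral>w. cis ((- (1 / s) *\<^sub>R t) \<bullet> w) \<partial>\<nu>) \<partial>std_gaussian)"
  proof (intro Bochner_Integration.integral_cong refl)
    fix t :: 'e
    have "cis (((x - w) /\<^sub>R s) \<bullet> t) = cis (t \<bullet> x / s) * cis ((- (1 / s) *\<^sub>R t) \<bullet> w)" for w
      by (simp add: cis_mult inner_diff_left inner_diff_right inner_commute field_simps diff_divide_distrib)
    then show "(\<integral>w. cis (((x - w) /\<^sub>R s) \<bullet> t) \<partial>\<nu>) = cis (t \<bullet> x / s) * (\<integral>w. cis ((- (1 / s) *\<^sub>R t) \<bullet> w) \<partial>\<nu>)"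
      by simp
  qed
  finally show ?thesis by (simp add: c_def)
qed

text \<open>The events may vary with n because the difference of the measures is bounded by the L1
  distance of the densities, whatever the event. This is what allows the sublevel sets of a changing
  statistic.\<close>

lemma gaussian_smoothing_tendsto:
  fixes \<nu> :: "nat \<Rightarrow> 'e::euclidean_space measure" and \<nu>' :: "'e measure"
  assumes s: "s > 0"
    and \<nu>: "\<And>n. prob_space (\<nu> n)" and sets_\<nu>: "\<And>n. sets (\<nu> n) = sets borel"
    and \<nu>': "prob_space \<nu>'" and sets_\<nu>': "sets \<nu>' = sets borel"
    and char_tendsto: "\<And>t. (\<lambda>n. \<integral>w. cis (t \<bullet> w) \<partial>\<nu> n) \<longlonglongrightarrow> (\<integral>w. cis (t \<bullet> w) \<partial>\<nu>')"
    and A: "\<And>n. A n \<in> sets borel"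
  shows "(\<lambda>n. measure (gaussian_smoothing s (\<nu> n)) (A n) - measure (gaussian_smoothing s \<nu>') (A n)) \<longlonglongrightarrow> 0"
proof -
  note [measurable_cong] = sets_\<nu> sets_\<nu>'
  note [measurable] = measurable_smoothed_density [OF \<nu> sets_\<nu>] measurable_smoothed_density [OF \<nu>' sets_\<nu>'] A
  define f where "f n = smoothed_density s (\<nu> n)" for n
  define g where "g = smoothed_density s \<nu>'"
  have [measurable]: "f n \<in> borel_measurable borel" "g \<in> borel_measurable borel" for n
    by (simp_all add: f_def g_def)
  have nonneg: "f n x \<ge> 0" "g x \<ge> 0" for n x
    using s by (simp_all add: f_def g_def smoothed_density_nonneg)
  have lim: "(\<lambda>n. f n x) \<longlonglongrightarrow> g x" for x
  proof -
    have "(\<lambda>n. complex_of_real (f n x)) \<longlonglongrightarrow> complex_of_real (g x)"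
      unfolding f_def g_def
        smoothed_density_eq_char [OF s \<nu> sets_\<nu>] smoothed_density_eq_char [OF s \<nu>' sets_\<nu>']
    \<comment> \<open>Characteristic functions are bounded by 1, so convergence under the Gaussian
      integral is dominated by a constant.\<close>
    proof (intro tendsto_divide tendsto_const
        integral_dominated_convergence [where w = "\<lambda>_. 1"] AE_I2 tendsto_mult char_tendsto)
      fix n and t :: 'e
      have "norm (\<integral>w. cis ((- (1 / s) *\<^sub>R t) \<bullet> w) \<partial>\<nu> n) \<le> (\<integral>w. norm (cis ((- (1 / s) *\<^sub>R t) \<bullet> w)) \<partial>\<nu> n)"
        by (rule integral_norm_bound)
      also have "\<dots> = 1"
        using prob_space.prob_space [OF \<nu>] by simp
      finally show "norm (cis (t \<bullet> x / s) * (\<integral>w. cis ((- (1 / s) *\<^sub>R t) \<bullet> w) \<partial>\<nu> n)) \<le> 1"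
        by (simp add: norm_mult)
    next
      interpret prob_space \<nu>' by fact
      show "(\<lambda>t. cis (t \<bullet> x / s) * (\<integral>w. cis ((- (1 / s) *\<^sub>R t) \<bullet> w) \<partial>\<nu>')) \<in> borel_measurable std_gaussian"
        unfolding cis_conv_exp by measurable
    next
      fix n
      interpret prob_space "\<nu> n" by fact
      show "(\<lambda>t. cis (t \<bullet> x / s) * (\<integral>w. cis ((- (1 / s) *\<^sub>R t) \<bullet> w) \<partial>\<nu> n)) \<in> borel_measurable std_gaussian"
        unfolding cis_conv_exp by measurable
    qed (use s in simp_all)
    then show ?thesis
      by (simp add: tendsto_of_real_iff)
  qed
  have total: "(\<integral>\<^sup>+x. ennreal (f n x) \<partial>lborel) = 1" "(\<integral>\<^sup>+x. ennreal (g x) \<partial>lborel) = 1" for n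
    using emeasure_gaussian_smoothing [OF s \<nu> sets_\<nu>, of UNIV n] emeasure_gaussian_smoothing [OF s \<nu>' sets_\<nu>', of UNIV]
      prob_space.emeasure_space_1 [OF prob_space_gaussian_smoothing [OF \<nu> sets_\<nu>, of s n]]
      prob_space.emeasure_space_1 [OF prob_space_gaussian_smoothing [OF \<nu>' sets_\<nu>', of s]]
    by (simp_all add: f_def g_def gaussian_smoothing_def)
  have int: "integrable lborel (f n)" "integrable lborel g" for n
    using nonneg by (auto intro!: integrableI_nonneg simp: total)
  have meas: "measure (gaussian_smoothing s (\<nu> n)) B = (\<integral>x. f n x * indicator B x \<partial>lborel)"
      "measure (gaussian_smoothing s \<nu>') B = (\<integral>x. g x * indicator B x \<partial>lborel)" if [measurable]: "B \<in> sets borel" for B n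
    using emeasure_gaussian_smoothing [OF s \<nu> sets_\<nu> that, of n] emeasure_gaussian_smoothing [OF s \<nu>' sets_\<nu>' that] nonneg
    by (auto simp: measure_def f_def g_def integral_eq_nn_integral ennreal_mult' ennreal_indicator)
  \<comment> \<open>All densities have mass one, so pointwise convergence already implies L1
    convergence (Scheffe).\<close>
  have "(\<lambda>n. \<integral>\<^sup>+x. ennreal (norm (f n x - g x)) \<partial>lborel) \<longlonglongrightarrow> 0"
    using nonneg total by (intro Scheffe_lemma2) (auto simp: lim int)
  then have "(\<lambda>n. enn2real (\<integral>\<^sup>+x. ennreal (norm (f n x - g x)) \<partial>lborel)) \<longlonglongrightarrow> enn2real 0"
    by (intro tendsto_intros) auto
  then have L1: "(\<lambda>n. \<integral>x. \<bar>f n x - g x\<bar> \<partial>lborel) \<longlonglongrightarrow> 0"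
    by (simp add: integral_eq_nn_integral)
  show ?thesis
  proof (rule Lim_null_comparison [OF always_eventually L1], rule allI)
    fix n
    have i: "integrable lborel (\<lambda>x. f n x * indicator (A n) x)" "integrable lborel (\<lambda>x. g x * indicator (A n) x)"
      using int by (auto intro: integrable_real_mult_indicator simp: mult.commute)
    have "norm (measure (gaussian_smoothing s (\<nu> n)) (A n) - measure (gaussian_smoothing s \<nu>') (A n))
        = norm (\<integral>x. f n x * indicator (A n) x - g x * indicator (A n) x \<partial>lborel)"
      using i by (simp add: meas)
    also have "\<dots> \<le> (\<integral>x. norm (f n x * indicator (A n) x - g x * indicator (A n) x) \<partial>lborel)"
      by (rule integral_norm_bound)
    also have "\<dots> \<le> (\<integral>x. \<bar>f n x - g x\<bar> \<partial>lborel)"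
      using i int by (intro integral_mono) (auto simp: indicator_def)
    finally show "norm (measure (gaussian_smoothing s (\<nu> n)) (A n) - measure (gaussian_smoothing s \<nu>') (A n))
        \<le> (\<integral>x. \<bar>f n x - g x\<bar> \<partial>lborel)" .
  qed
qed

section \<open>Uniqueness of characteristic functions and chi-square laws\<close>

text \<open>Removes the smoothing again: on the product space the scaled noise tends to zero
  pointwise. Needed to pass from uniqueness of smoothed laws to uniqueness of laws.\<close>

lemma integral_gaussian_smoothing_tendsto:
  fixes \<nu> :: "'e::euclidean_space measure" and f :: "'e \<Rightarrow> real"
  assumes "prob_space \<nu>" and sets_\<nu>[measurable_cong]: "sets \<nu> = sets borel"
    and cont: "continuous_on UNIV f" and bound: "\<And>x. \<bar>f x\<bar> \<le> C"
  shows "(\<lambda>n. \<integral>x. f x \<partial>gaussian_smoothing (1 / real (Suc n)) \<nu>) \<longlonglongrightarrow> (\<integral>x. f x \<partial>\<nu>)"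
proof -
  interpret prob_space \<nu> by fact
  interpret pair_prob_space \<nu> "std_gaussian :: 'e measure" by unfold_locales
  have [measurable]: "f \<in> borel_measurable borel"
    using cont by (rule borel_measurable_continuous_onI)
  have "(\<lambda>n. \<integral>p. f (fst p + (1 / real (Suc n)) *\<^sub>R snd p) \<partial>(\<nu> \<Otimes>\<^sub>M std_gaussian))
      \<longlonglongrightarrow> (\<integral>p. f (fst p) \<partial>(\<nu> \<Otimes>\<^sub>M (std_gaussian :: 'e measure)))"
  proof (rule integral_dominated_convergence [where w = "\<lambda>_. C"])
    show "AE p in \<nu> \<Otimes>\<^sub>M std_gaussian. (\<lambda>n. f (fst p + (1 / real (Suc n)) *\<^sub>R snd p)) \<longlonglongrightarrow> f (fst p)"
    proof (rule AE_I2)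
      fix p :: "'e \<times> 'e"
      have "(\<lambda>n. fst p + (1 / real (Suc n)) *\<^sub>R snd p) \<longlonglongrightarrow> fst p + 0 *\<^sub>R snd p"
        by (intro tendsto_intros LIMSEQ_Suc [OF lim_1_over_n])
      then show "(\<lambda>n. f (fst p + (1 / real (Suc n)) *\<^sub>R snd p)) \<longlonglongrightarrow> f (fst p)"
        using cont by (auto simp: continuous_on_eq_continuous_at intro: isCont_tendsto_compose)
    qed
  qed (use bound in auto)
  moreover have "(\<integral>p. f (fst p) \<partial>(\<nu> \<Otimes>\<^sub>M (std_gaussian :: 'e measure))) = (\<integral>x. f x \<partial>\<nu>)"
    by (subst (2) std_gaussian.distr_pair_fst [of \<nu>, symmetric]) (subst integral_distr, auto)
  ultimately show ?thesis
    by (simp add: gaussian_smoothing_def integral_distr split_beta')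
qed

text \<open>The characteristic function fixes every smoothed density; letting the noise shrink gives
  equal integrals of bounded continuous functions, and these approximate the indicators of open
  sets, an intersection-stable generator.\<close>

lemma char_determines_measure:
  fixes \<mu> \<nu> :: "'e::euclidean_space measure"
  assumes \<mu>: "prob_space \<mu>" and sets_\<mu>[measurable_cong]: "sets \<mu> = sets borel"
    and \<nu>: "prob_space \<nu>" and sets_\<nu>[measurable_cong]: "sets \<nu> = sets borel"
    and char_eq: "\<And>t. (\<integral>w. cis (t \<bullet> w) \<partial>\<mu>) = (\<integral>w. cis (t \<bullet> w) \<partial>\<nu>)"
  shows "\<mu> = \<nu>"
proof (rule measure_eqI_generator_eq [where E = "{S. open S}" and \<Omega> = UNIV and A = "\<lambda>_. UNIV"])
  interpret \<mu>: prob_space \<mu> by fact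
  interpret \<nu>: prob_space \<nu> by fact
  have space_eq: "space \<mu> = UNIV" "space \<nu> = UNIV"
    using sets_eq_imp_space_eq[OF sets_\<mu>] sets_eq_imp_space_eq[OF sets_\<nu>] by simp_all
  have smoothing_eq: "gaussian_smoothing s \<mu> = gaussian_smoothing s \<nu>" if s: "s > 0" for s
  proof (rule measure_eqI)
    have "complex_of_real (smoothed_density s \<mu> x) = complex_of_real (smoothed_density s \<nu> x)" for x
      by (simp only: smoothed_density_eq_char [OF s \<mu> sets_\<mu>] smoothed_density_eq_char [OF s \<nu> sets_\<nu>] char_eq)
    then have "smoothed_density s \<mu> = smoothed_density s \<nu>"
      by (simp add: fun_eq_iff)
    then show "emeasure (gaussian_smoothing s \<mu>) A = emeasure (gaussian_smoothing s \<nu>) A"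
      if "A \<in> sets (gaussian_smoothing s \<mu>)" for A
      using that by (simp add: emeasure_gaussian_smoothing [OF s \<mu> sets_\<mu>] emeasure_gaussian_smoothing [OF s \<nu> sets_\<nu>]
          gaussian_smoothing_def[of s \<mu>, THEN arg_cong, of sets])
  qed (simp add: gaussian_smoothing_def)
  have integral_eq: "(\<integral>x. f x \<partial>\<mu>) = (\<integral>x. f x \<partial>\<nu>)"
    if "continuous_on UNIV f" "\<And>x. \<bar>f x\<bar> \<le> C" for f :: "'e \<Rightarrow> real" and C
    using LIMSEQ_unique [OF integral_gaussian_smoothing_tendsto [OF \<mu> sets_\<mu> that]]
      integral_gaussian_smoothing_tendsto [OF \<nu> sets_\<nu> that]
    by (simp add: smoothing_eq)
  fix S :: "'e set"
  assume "S \<in> {S. open S}"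
  then have S: "open S" by simp
  show "emeasure \<mu> S = emeasure \<nu> S"
  \<comment> \<open>By convention \<open>infdist x {}\<close> is 0, so the approximation by
    distances to the complement would give 0 for the whole space.\<close>
  proof (cases "S = UNIV")
    case True
    then show ?thesis
      using \<mu>.emeasure_space_1 \<nu>.emeasure_space_1 by (simp add: space_eq)
  next
    case False
    define f where "f n x = min 1 (real n * infdist x (- S))" for n and x :: 'e
    have cont: "continuous_on UNIV (f n)" for n
      unfolding f_def by (intro continuous_intros)
    have bound: "\<bar>f n x\<bar> \<le> 1" for n x
      by (simp add: f_def infdist_nonneg)
    have lim: "(\<lambda>n. f n x) \<longlonglongrightarrow> indicator S x" for x
    proof (cases "x \<in> S")
      case True
      then have "infdist x (- S) > 0"
        using S \<open>S \<noteq> UNIV\<close> in_closed_iff_infdist_zero [of "- S" x] infdist_nonneg [of x "- S"]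
        by (auto simp: less_le closed_Compl Compl_eq_Diff_UNIV)
      then have "eventually (\<lambda>n. real n * infdist x (- S) \<ge> 1) sequentially"
        by (auto intro!: eventually_sequentiallyI [of "nat \<lceil>1 / infdist x (- S)\<rceil>"] simp: field_simps le_nat_iff ceiling_le_iff)
      then have "eventually (\<lambda>n. f n x = 1) sequentially"
        by eventually_elim (simp add: f_def)
      with True show ?thesis
        by (simp add: tendsto_eventually)
    next
      case False
      then have "infdist x (- S) = 0"
        by simp
      with False show ?thesis
        by (simp add: f_def)
    qed
    have [measurable]: "f n \<in> borel_measurable borel" for n
      using cont by (rule borel_measurable_continuous_onI)
    have S'[measurable]: "S \<in> sets borel" using S by simp
    have "(\<lambda>n. \<integral>x. f n x \<partial>\<mu>) \<longlonglongrightarrow> (\<integral>x. indicator S x \<partial>\<mu>)"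
      by (rule integral_dominated_convergence [where w = "\<lambda>_. 1"]) (use bound lim in auto)
    moreover have "(\<lambda>n. \<integral>x. f n x \<partial>\<nu>) \<longlonglongrightarrow> (\<integral>x. indicator S x \<partial>\<nu>)"
      by (rule integral_dominated_convergence [where w = "\<lambda>_. 1"]) (use bound lim in auto)
    ultimately have "measure \<mu> S = measure \<nu> S"
      using LIMSEQ_unique integral_eq [OF cont bound] by (simp add: space_eq) blast
    then show ?thesis
      by (simp add: \<mu>.emeasure_eq_measure \<nu>.emeasure_eq_measure)
  qed
next
  show "emeasure \<mu> UNIV \<noteq> \<infinity>"
    using finite_measure.emeasure_finite [OF prob_space.finite_measure [OF \<mu>]] by simp
qed (auto simp: Int_stable_def sets_borel sets_\<mu> sets_\<nu>)

text \<open>The covariance of the image has the quadratic form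
  \<open>(norm (adjoint f t))\<^sup>2\<close>. Singular covariances are included, as the multinomial
  limit requires.\<close>

lemma char_distr_std_gaussian:
  fixes f :: "'e::euclidean_space \<Rightarrow> 'f::euclidean_space"
  assumes "linear f"
  shows "(\<integral>w. cis (t \<bullet> w) \<partial>distr std_gaussian borel f) = of_real (exp (- (norm (adjoint f t))\<^sup>2 / 2))"
proof -
  have [measurable]: "f \<in> borel_measurable borel"
    using assms by (intro borel_measurable_continuous_onI linear_continuous_on) (simp add: linear_conv_bounded_linear)
  have "(\<integral>w. cis (t \<bullet> w) \<partial>distr std_gaussian borel f) = (\<integral>g. cis (adjoint f t \<bullet> g) \<partial>std_gaussian)"
    by (subst integral_distr) (auto simp: cis_conv_exp adjoint_works [OF assms] inner_commute)
  then show ?thesis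
    by (simp only: char_std_gaussian)
qed

text \<open>The chi-square law lives on the index set \<open>{..<k}\<close>; a bijection onto
  \<open>I\<close> and the marginals of a product measure carry it to coordinates of the Gaussian
  vector.\<close>

lemma distr_std_gaussian_sum_coordinates:
  fixes I :: "'e::euclidean_space set"
  assumes I: "I \<subseteq> Basis"
  shows "distr std_gaussian borel (\<lambda>g. \<Sum>i\<in>I. (g \<bullet> i)\<^sup>2) = chi_square_distribution (card I)"
proof -
  have ps: "prob_space std_normal_distribution"
    using real_dist_normal_dist by (simp add: real_distribution_def)
  have "finite I" using I finite_Basis finite_subset by blast
  then obtain h where h: "bij_betw h {..<card I} I"
    using ex_bij_betw_nat_finite [of I] by (auto simp: atLeast0LessThan)
  then have inj: "inj_on h {..<card I}" and range: "h \<in> {..<card I} \<rightarrow> Basis"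
    using I by (auto simp: bij_betw_def)
  have "(\<Pi>\<^sub>M i\<in>{..<card I}. std_normal_distribution) =
      distr (\<Pi>\<^sub>M b\<in>(Basis::'e set). std_normal_distribution) (\<Pi>\<^sub>M i\<in>{..<card I}. std_normal_distribution)
        (\<lambda>\<omega>. \<lambda>n\<in>{..<card I}. \<omega> (h n))"
    using ps inj range by (intro distr_PiM_reindex [symmetric]) auto
  also have "\<dots> = distr (\<Pi>\<^sub>M b\<in>(Basis::'e set). std_normal_distribution) (\<Pi>\<^sub>M i\<in>{..<card I}. borel)
        (\<lambda>\<omega>. \<lambda>n\<in>{..<card I}. \<omega> (h n))"
    by (intro distr_cong refl sets_PiM_cong) auto
  also have "\<dots> = distr std_gaussian (\<Pi>\<^sub>M i\<in>{..<card I}. borel) (\<lambda>g::'e. \<lambda>n\<in>{..<card I}. g \<bullet> h n)"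
    using range unfolding distr_std_gaussian_components [symmetric]
    by (subst distr_distr)
       (auto simp: o_def Pi_iff intro!: distr_cong measurable_restrict measurable_component_singleton restrict_ext)
  finally have "chi_square_distribution (card I) =
      distr (distr std_gaussian (\<Pi>\<^sub>M i\<in>{..<card I}. borel) (\<lambda>g::'e. \<lambda>n\<in>{..<card I}. g \<bullet> h n)) borel (\<lambda>x. \<Sum>i<card I. (x i)\<^sup>2)"
    by (simp add: chi_square_distribution_def)
  also have "\<dots> = distr std_gaussian borel (\<lambda>g::'e. \<Sum>n<card I. (g \<bullet> h n)\<^sup>2)"
    by (subst distr_distr) (auto simp: o_def intro!: distr_cong)
  also have "(\<lambda>g::'e. \<Sum>n<card I. (g \<bullet> h n)\<^sup>2) = (\<lambda>g. \<Sum>i\<in>I. (g \<bullet> i)\<^sup>2)"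
    using sum.reindex_bij_betw [OF h] by fast
  finally show ?thesis ..
qed

lemma norm_sum_orthonormal_power2:
  fixes e :: "'i \<Rightarrow> 'e::euclidean_space"
  assumes "finite I" "\<And>i j. i \<in> I \<Longrightarrow> j \<in> I \<Longrightarrow> i \<noteq> j \<Longrightarrow> orthogonal (e i) (e j)" "\<And>i. i \<in> I \<Longrightarrow> norm (e i) = 1"
  shows "(norm (\<Sum>i\<in>I. c i *\<^sub>R e i))\<^sup>2 = (\<Sum>i\<in>I. (c i)\<^sup>2)"
  using assms
  by (subst norm_sum_Pythagorean) (auto simp: pairwise_def orthogonal_clauses power_mult_distrib)

text \<open>Both sums of squares are squared norms of linear images of the Gaussian vector with the
  same characteristic function.\<close>

lemma distr_std_gaussian_sum_orthonormal:
  fixes B :: "'e::euclidean_space set"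
  assumes B: "finite B" "pairwise orthogonal B" "\<And>b. b \<in> B \<Longrightarrow> norm b = 1"
  shows "distr std_gaussian borel (\<lambda>g. \<Sum>b\<in>B. (b \<bullet> g)\<^sup>2) = chi_square_distribution (card B)"
proof -
  have orth: "orthogonal b b'" if "b \<in> B" "b' \<in> B" "b \<noteq> b'" for b b'
    using that B(2) by (auto simp: pairwise_def)
  have "0 \<notin> B" using B(3) by force
  \<comment> \<open>An orthonormal family is independent, so there are enough coordinate axes
    \<open>I\<close> to match it.\<close>
  then have "card B \<le> DIM('e)"
    using B(2) independent_bound pairwise_orthogonal_independent by blast
  then obtain I :: "'e set" where I: "I \<subseteq> Basis" "card I = card B"
    by (rule obtain_subset_with_card_n)
  then have "finite I" using finite_Basis finite_subset by blast
  with B(1) I(2) obtain h where h: "bij_betw h B I"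
    using finite_same_card_bij [of B I] by auto
  then have inj: "inj_on h B" and hB: "h ` B = I"
    by (auto simp: bij_betw_def)
  have h_Basis: "h b \<in> Basis" if "b \<in> B" for b
    using that hB I(1) by auto
  have orth_h: "orthogonal (h b) (h b')" if "b \<in> B" "b' \<in> B" "b \<noteq> b'" for b b'
    using that h_Basis inj by (auto simp: orthogonal_def inner_Basis inj_on_def)
  \<comment> \<open>\<open>f\<close> carries the frame \<open>B\<close> to the frame
    \<open>I\<close>, while \<open>f'\<close> projects onto the span of \<open>I\<close>. The
    adjoints of both have squared norm equal to the sum of the squares of
    \<open>h b \<bullet> t\<close> over \<open>B\<close>.\<close>
  define f where "f g = (\<Sum>b\<in>B. (b \<bullet> g) *\<^sub>R h b)" for g
  define f' where "f' g = (\<Sum>b\<in>B. (h b \<bullet> g) *\<^sub>R h b)" for g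
  have lin: "linear f" "linear f'"
    by (rule linearI; simp add: f_def f'_def inner_add_right scaleR_left_distrib sum.distrib scaleR_sum_right)+
  have [measurable]: "f \<in> borel_measurable borel" "f' \<in> borel_measurable borel"
    unfolding f_def f'_def by measurable
  have adj: "adjoint f = (\<lambda>t. \<Sum>b\<in>B. (h b \<bullet> t) *\<^sub>R b)" "adjoint f' = (\<lambda>t. \<Sum>b\<in>B. (h b \<bullet> t) *\<^sub>R h b)"
    by (intro adjoint_unique allI; unfold f_def f'_def inner_sum_left inner_sum_right;
        intro sum.cong refl; simp add: inner_commute)+
  have "distr std_gaussian borel f = distr std_gaussian borel f'"
  proof (rule char_determines_measure)
    fix t
    have "(norm (adjoint f t))\<^sup>2 = (norm (adjoint f' t))\<^sup>2"
      using B h_Basis orth orth_h by (simp add: adj norm_sum_orthonormal_power2)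
    then show "(\<integral>w. cis (t \<bullet> w) \<partial>distr std_gaussian borel f) = (\<integral>w. cis (t \<bullet> w) \<partial>distr std_gaussian borel f')"
      by (simp add: char_distr_std_gaussian lin)
  qed (auto intro!: std_gaussian.prob_space_distr)
  then have "distr (distr std_gaussian borel f) borel (\<lambda>x. (norm x)\<^sup>2) = distr (distr std_gaussian borel f') borel (\<lambda>x. (norm x)\<^sup>2)"
    by simp
  then have "distr std_gaussian borel (\<lambda>g. (norm (f g))\<^sup>2) = distr std_gaussian borel (\<lambda>g. (norm (f' g))\<^sup>2)"
    by (simp add: distr_distr o_def)
  moreover have "(norm (f g))\<^sup>2 = (\<Sum>b\<in>B. (b \<bullet> g)\<^sup>2)" for g
    using B h_Basis orth_h by (simp add: f_def norm_sum_orthonormal_power2)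
  moreover have "(norm (f' g))\<^sup>2 = (\<Sum>i\<in>I. (g \<bullet> i)\<^sup>2)" for g
    using B h_Basis orth_h sum.reindex [OF inj, of "\<lambda>i. (g \<bullet> i)\<^sup>2"]
    by (simp add: f'_def norm_sum_orthonormal_power2 hB inner_commute)
  ultimately show ?thesis
    using distr_std_gaussian_sum_coordinates [OF I(1)] I(2) by simp
qed

section \<open>Characteristic functions of contingency tables\<close>

text \<open>The central limit theorem for a centred variable with finitely many values
  \<open>y k\<close>, taken with weights \<open>p k\<close>: the base of the power is compared with
  1 - v / (2 n), where \<open>v\<close> is the variance.\<close>

lemma char_power_tendsto:
  fixes p y :: "'k::finite \<Rightarrow> real"
  assumes p: "\<And>k. p k \<ge> 0" "(\<Sum>k\<in>UNIV. p k) = 1"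
    and mean: "(\<Sum>k\<in>UNIV. p k * y k) = 0"
  shows "(\<lambda>n. (\<Sum>k\<in>UNIV. of_real (p k) * cis (y k / sqrt (real n))) ^ n) \<longlonglongrightarrow>
     complex_of_real (exp (- (\<Sum>k\<in>UNIV. p k * (y k)\<^sup>2) / 2))"
proof -
  define v where "v = (\<Sum>k\<in>UNIV. p k * (y k)\<^sup>2)"
  define z where "z n = (\<Sum>k\<in>UNIV. of_real (p k) * cis (y k / sqrt (real n)))" for n :: nat
  define w where "w n = complex_of_real (1 + (- v / 2) / real n)" for n :: nat
  \<comment> \<open>One sixth of the third absolute moment, the constant in the second-order Taylor
    remainder of \<open>cis\<close>.\<close>
  define C where "C = (\<Sum>k\<in>UNIV. p k * \<bar>y k\<bar> ^ 3 / 6)"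
  have v: "v \<ge> 0"
    unfolding v_def using p by (intro sum_nonneg) auto
  have norm_z: "norm (z n) \<le> 1" for n
  proof -
    have "norm (z n) \<le> (\<Sum>k\<in>UNIV. norm (of_real (p k) * cis (y k / sqrt (real n))))"
      unfolding z_def by (rule norm_sum)
    also have "\<dots> = 1"
      using p by (simp add: norm_mult)
    finally show ?thesis .
  qed
  \<comment> \<open>The comparison of powers needs both bases in the unit disc; for small n the
    number 1 - v / (2 n) may lie below -1.\<close>
  have norm_w: "norm (w n) \<le> 1" if "real n \<ge> v + 1" for n
  proof -
    have "\<bar>1 + (- v / 2) / real n\<bar> \<le> 1"
      using that v by (auto simp: abs_le_iff field_simps)
    then show ?thesis
      unfolding w_def norm_of_real .
  qed
  have diff: "norm (z n - w n) \<le> C / (real n * sqrt (real n))" if n: "n > 0" for n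
  proof -
    define x where "x k = y k / sqrt (real n)" for k
    have 1: "(\<Sum>k\<in>UNIV. p k * x k) = 0"
      using mean by (simp add: x_def flip: sum_divide_distrib)
    have 2: "(\<Sum>k\<in>UNIV. p k * (x k)\<^sup>2 / 2) = v / 2 / real n"
      by (simp add: x_def v_def power_divide sum_divide_distrib mult.commute)
    have "(\<Sum>k\<in>UNIV. of_real (p k) * (1 + \<i> * x k - (x k)\<^sup>2 / 2)) =
        complex_of_real (\<Sum>k\<in>UNIV. p k) + \<i> * of_real (\<Sum>k\<in>UNIV. p k * x k) - of_real (\<Sum>k\<in>UNIV. p k * (x k)\<^sup>2 / 2)"
      by (simp add: algebra_simps sum.distrib sum_subtractf sum_distrib_left)
    then have w: "w n = (\<Sum>k\<in>UNIV. of_real (p k) * (1 + \<i> * x k - (x k)\<^sup>2 / 2))"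
      by (simp only: 1 2 p w_def) simp
    have "norm (z n - w n) = norm (\<Sum>k\<in>UNIV. of_real (p k) * (cis (x k) - (1 + \<i> * x k - (x k)\<^sup>2 / 2)))"
      by (simp add: w z_def x_def right_diff_distrib sum_subtractf)
    also have "\<dots> \<le> (\<Sum>k\<in>UNIV. norm (of_real (p k) * (cis (x k) - (1 + \<i> * x k - (x k)\<^sup>2 / 2))))"
      by (rule norm_sum)
    also have "\<dots> \<le> (\<Sum>k\<in>UNIV. p k * (\<bar>x k\<bar> ^ 3 / 6))"
    proof (rule sum_mono)
      fix k
      have "norm (cis (x k) - (1 + \<i> * x k - (x k)\<^sup>2 / 2)) \<le> \<bar>x k\<bar> ^ 3 / 6"
        using iexp_approx1 [of "x k" 2]
        by (simp add: eval_nat_numeral cis_conv_exp atMost_Suc fact_reduce algebra_simps)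
      then have "p k * norm (cis (x k) - (1 + \<i> * x k - (x k)\<^sup>2 / 2)) \<le> p k * (\<bar>x k\<bar> ^ 3 / 6)"
        using p(1) by (rule mult_left_mono)
      then show "norm (of_real (p k) * (cis (x k) - (1 + \<i> * x k - (x k)\<^sup>2 / 2))) \<le> p k * (\<bar>x k\<bar> ^ 3 / 6)"
        by (simp only: norm_mult norm_of_real abs_of_nonneg [OF p(1)])
    qed
    also have "\<dots> = C / (real n * sqrt (real n))"
      by (simp add: C_def x_def power_divide sum_divide_distrib power3_eq_cube mult_ac)
    finally show ?thesis .
  qed
  have "(\<lambda>n. C / sqrt (real n)) \<longlonglongrightarrow> 0"
    by (intro real_tendsto_divide_at_top [where c = C] tendsto_const filterlim_compose [OF sqrt_at_top filterlim_real_sequentially])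
  moreover have "eventually (\<lambda>n. norm (z n ^ n - w n ^ n) \<le> C / sqrt (real n)) sequentially"
  proof (rule eventually_sequentiallyI)
    fix n assume "n \<ge> nat \<lceil>v + 1\<rceil>"
    then have n: "real n \<ge> v + 1"
      by linarith
    with v have "n > 0"
      by (cases n) auto
    \<comment> \<open>Taking powers in the unit disc multiplies a distance by at most n, which the
      order n^(-3/2) of the single-step error absorbs.\<close>
    have "norm (z n ^ n - w n ^ n) \<le> real n * norm (z n - w n)"
      by (rule norm_power_diff [OF norm_z norm_w [OF n]])
    also have "\<dots> \<le> real n * (C / (real n * sqrt (real n)))"
      using \<open>n > 0\<close> diff by (intro mult_left_mono) auto
    also have "\<dots> = C / sqrt (real n)"
      using \<open>n > 0\<close> by simp
    finally show "norm (z n ^ n - w n ^ n) \<le> C / sqrt (real n)" .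
  qed
  ultimately have "(\<lambda>n. z n ^ n - w n ^ n) \<longlonglongrightarrow> 0"
    by (rule Lim_null_comparison [rotated])
  moreover have "(\<lambda>n. w n ^ n) \<longlonglongrightarrow> complex_of_real (exp (- v / 2))"
    unfolding w_def of_real_power [symmetric] by (intro tendsto_of_real tendsto_exp_limit_sequentially)
  ultimately show ?thesis
    using tendsto_add [of "\<lambda>n. z n ^ n - w n ^ n" 0 sequentially "\<lambda>n. w n ^ n"] by (simp add: z_def v_def)
qed

section \<open>From a single observation to the characteristic function of the table\<close>

definition cell_indicator :: "real^'r \<Rightarrow> real^'c \<Rightarrow> real^('r::finite \<times> 'c::finite)" where
  "cell_indicator u v = (\<chi> k. of_bool (u $ fst k = 1 \<and> v $ snd k = 1))"

lemma contingency_table_eq_sum: "contingency_table n u v = (\<Sum>l=1..n. cell_indicator (u l) (v l))"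
  by (simp add: contingency_table_def cell_indicator_def vec_eq_iff)

lemma cell_indicator_axis: "cell_indicator (axis i 1) (axis j 1) = axis (i, j) 1"
  by (auto simp: cell_indicator_def vec_eq_iff axis_def)

lemma measurable_cell_indicator [measurable]:
  "(\<lambda>(u, v). cell_indicator u v) \<in> borel_measurable (borel \<Otimes>\<^sub>M borel)"
proof -
  have "(\<lambda>(u, v). cell_indicator (u :: real^'r) (v :: real^'c)) = (\<lambda>p. \<Sum>k\<in>UNIV.
      of_bool (fst p $ fst k = 1 \<and> snd p $ snd k = 1) *\<^sub>R axis k 1)"
    by (auto simp: fun_eq_iff cell_indicator_def vec_eq_iff axis_def if_distrib [where f = "\<lambda>x. _ * x"] cong: if_cong)
  also have "\<dots> \<in> borel_measurable (borel \<Otimes>\<^sub>M borel)"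
    by measurable
  finally show ?thesis .
qed

text \<open>The prescribed atoms are disjoint and their probabilities already add up to one.\<close>

lemma (in prob_space) multinomial1_AE:
  assumes "multinomial1_distributed M X p" and "p \<in> positive_prob_vectors"
  shows "AE \<omega> in M. \<exists>j. X \<omega> = axis j 1"
proof -
  have [measurable]: "X \<in> borel_measurable M"
    using assms(1) by (simp add: multinomial1_distributed_def)
  have "prob (\<Union>j\<in>UNIV. {\<omega> \<in> space M. X \<omega> = axis j 1}) = (\<Sum>j\<in>UNIV. prob {\<omega> \<in> space M. X \<omega> = axis j 1})"
    by (intro finite_measure_finite_Union) (auto simp: disjoint_family_on_def axis_eq_axis)
  also have "\<dots> = 1"
    using assms by (simp add: multinomial1_distributed_def positive_prob_vectors_def)
  finally have "AE \<omega> in M. \<omega> \<in> (\<Union>j\<in>UNIV. {\<omega> \<in> space M. X \<omega> = axis j 1})"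
    by (simp add: prob_eq_1)
  then show ?thesis by (rule AE_mp) auto
qed

lemma (in prob_space) independent_rvs_prob:
  assumes "independent_rvs M S X T Y" "A \<in> sets S" "B \<in> sets T"
  shows "prob {\<omega> \<in> space M. X \<omega> \<in> A \<and> Y \<omega> \<in> B} = prob {\<omega> \<in> space M. X \<omega> \<in> A} * prob {\<omega> \<in> space M. Y \<omega> \<in> B}"
proof -
  have "indep_set {X -` A \<inter> space M | A. A \<in> sets S} {Y -` B \<inter> space M | B. B \<in> sets T}"
    using assms(1) by (simp add: independent_rvs_def)
  then have "prob ((X -` A \<inter> space M) \<inter> (Y -` B \<inter> space M)) = prob (X -` A \<inter> space M) * prob (Y -` B \<inter> space M)"
    by (rule indep_setD) (use assms in auto)
  moreover have "(X -` A \<inter> space M) \<inter> (Y -` B \<inter> space M) = {\<omega> \<in> space M. X \<omega> \<in> A \<and> Y \<omega> \<in> B}"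
    "X -` A \<inter> space M = {\<omega> \<in> space M. X \<omega> \<in> A}" "Y -` B \<inter> space M = {\<omega> \<in> space M. Y \<omega> \<in> B}"
    by auto
  ultimately show ?thesis by simp
qed

text \<open>Here the independence of \<open>U\<close> and \<open>V\<close> enters: it makes the
  probability of a cell the product of its margins.\<close>

lemma (in prob_space) expectation_cell_indicator:
  fixes f :: "real^('r::finite \<times> 'c::finite) \<Rightarrow> complex"
  assumes U: "multinomial1_distributed M U p" "p \<in> positive_prob_vectors"
    and V: "multinomial1_distributed M V q" "q \<in> positive_prob_vectors"
    and indep: "independent_rvs M borel U borel V"
    and f[measurable]: "f \<in> borel_measurable borel"
  shows "(\<integral>\<omega>. f (cell_indicator (U \<omega>) (V \<omega>)) \<partial>M) = (\<Sum>k\<in>UNIV. of_real (product_table p q $ k) * f (axis k 1))"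
proof -
  have [measurable]: "U \<in> borel_measurable M" "V \<in> borel_measurable M"
    using U V by (simp_all add: multinomial1_distributed_def)
  define E where "E k = {\<omega> \<in> space M. U \<omega> \<in> {axis (fst k) 1} \<and> V \<omega> \<in> {axis (snd k) 1}}" for k
  have [measurable]: "E k \<in> sets M" for k
    unfolding E_def by measurable
  have prob_E: "prob (E k) = product_table p q $ k" for k
    using U V unfolding E_def
    by (subst independent_rvs_prob [OF indep]) (auto simp: multinomial1_distributed_def product_table_def)
  have "(\<integral>\<omega>. f (cell_indicator (U \<omega>) (V \<omega>)) \<partial>M) = (\<integral>\<omega>. (\<Sum>k\<in>UNIV. indicator (E k) \<omega> *\<^sub>R f (axis k 1)) \<partial>M)"
  proof (rule integral_cong_AE)
    show "AE \<omega> in M. f (cell_indicator (U \<omega>) (V \<omega>)) = (\<Sum>k\<in>UNIV. indicator (E k) \<omega> *\<^sub>R f (axis k 1))"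
      using multinomial1_AE [OF U] multinomial1_AE [OF V] AE_space
    proof eventually_elim
      case (elim \<omega>)
      then obtain i j where ij: "U \<omega> = axis i 1" "V \<omega> = axis j 1" "\<omega> \<in> space M" by auto
      then have "indicator (E k) \<omega> *\<^sub>R f (axis k 1) = (if k = (i, j) then f (axis k 1) else 0)" for k
        by (cases k) (auto simp: E_def axis_eq_axis)
      with ij show ?case by (simp add: cell_indicator_axis)
    qed
  qed measurable
  also have "\<dots> = (\<Sum>k\<in>UNIV. prob (E k) *\<^sub>R f (axis k 1))"
  proof (subst Bochner_Integration.integral_sum)
    have int: "integrable M (indicat_real (E k))" for k
      by (simp add: emeasure_eq_measure)
    then show "integrable M (\<lambda>\<omega>. indicator (E k) \<omega> *\<^sub>R f (axis k 1))" for k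
      by (rule integrable_scaleR_left)
    show "(\<Sum>k\<in>UNIV. \<integral>\<omega>. indicator (E k) \<omega> *\<^sub>R f (axis k 1) \<partial>M) = (\<Sum>k\<in>UNIV. prob (E k) *\<^sub>R f (axis k 1))"
      using int by (simp add: E_def)
  qed
  finally show ?thesis
    by (simp add: prob_E scaleR_conv_of_real)
qed

lemma (in prob_space) char_contingency_table:
  fixes U :: "nat \<Rightarrow> 'a \<Rightarrow> real^'r::finite" and V :: "nat \<Rightarrow> 'a \<Rightarrow> real^'c::finite"
  assumes U: "\<And>l. l \<in> {1..n} \<Longrightarrow> multinomial1_distributed M (U l) p" and p: "p \<in> positive_prob_vectors"
    and V: "\<And>l. l \<in> {1..n} \<Longrightarrow> multinomial1_distributed M (V l) q" and q: "q \<in> positive_prob_vectors"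
    and indep: "\<And>l. l \<in> {1..n} \<Longrightarrow> independent_rvs M borel (U l) borel (V l)"
    and pairs_indep: "indep_vars (\<lambda>_. borel) (\<lambda>l \<omega>. (U l \<omega>, V l \<omega>)) {1..n}"
    and n: "n \<ge> 1"
  shows "(\<integral>\<omega>. cis (t \<bullet> ((1 / sqrt n) *\<^sub>R (contingency_table n (\<lambda>l. U l \<omega>) (\<lambda>l. V l \<omega>) - real n *\<^sub>R product_table p q))) \<partial>M) =
    (\<Sum>k\<in>UNIV. of_real (product_table p q $ k) * cis ((t $ k - t \<bullet> product_table p q) / sqrt n)) ^ n"
proof -
  \<comment> \<open>Subtracting n p from the table amounts to centring each of the n summands by
    \<open>m\<close>, so the integrand is a product of independent factors.\<close>
  define m where "m = t \<bullet> product_table p q"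
  define g where "g x = cis ((t \<bullet> x - m) / sqrt n)" for x
  have [measurable]: "g \<in> borel_measurable borel"
    unfolding g_def cis_conv_exp by measurable
  define c where "c l \<omega> = g (cell_indicator (U l \<omega>) (V l \<omega>))" for l \<omega>
  have c_indep: "indep_vars (\<lambda>_. borel) c {1..n}"
    using indep_vars_compose2 [OF pairs_indep, of "\<lambda>_ (u, v). g (cell_indicator u v)" "\<lambda>_. borel"]
    by (simp add: c_def[abs_def] borel_prod [symmetric])
  have "cis (t \<bullet> ((1 / sqrt n) *\<^sub>R (contingency_table n (\<lambda>l. U l \<omega>) (\<lambda>l. V l \<omega>) - real n *\<^sub>R product_table p q)))
     = (\<Prod>l=1..n. c l \<omega>)" for \<omega>
  proof -
    have "(\<Prod>l=1..n. c l \<omega>) = cis (\<Sum>l=1..n. (t \<bullet> cell_indicator (U l \<omega>) (V l \<omega>) - m) / sqrt n)"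
      by (simp add: c_def g_def cis_conv_exp exp_sum sum_distrib_left)
    then show ?thesis
      by (simp add: contingency_table_eq_sum inner_diff_right inner_sum_right sum_subtractf m_def flip: sum_divide_distrib)
  qed
  then have "(\<integral>\<omega>. cis (t \<bullet> ((1 / sqrt n) *\<^sub>R (contingency_table n (\<lambda>l. U l \<omega>) (\<lambda>l. V l \<omega>) - real n *\<^sub>R product_table p q))) \<partial>M)
      = (\<integral>\<omega>. (\<Prod>l=1..n. c l \<omega>) \<partial>M)"
    by simp
  also have "\<dots> = (\<Prod>l=1..n. \<integral>\<omega>. c l \<omega> \<partial>M)"
  proof (rule indep_vars_lebesgue_integral [OF _ c_indep])
    fix l assume "l \<in> {1..n}"
    then have "c l \<in> borel_measurable M"
      using c_indep by (simp add: indep_vars_def)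
    then show "integrable M (c l)"
      by (intro integrable_const_bound [where B = 1]) (auto simp: c_def g_def)
  qed simp
  also have "\<dots> = (\<Prod>l=1..n. \<Sum>k\<in>UNIV. of_real (product_table p q $ k) * g (axis k 1))"
    unfolding c_def using U V p q indep by (intro prod.cong refl expectation_cell_indicator) auto
  finally show ?thesis
    by (simp add: g_def m_def inner_axis)
qed

section \<open>Geometry of the limit statistic\<close>

lemma matrix_inv_mult:
  assumes "invertible A"
  shows "A ** matrix_inv A = mat 1" "matrix_inv A ** A = mat 1"
  using someI_ex [OF assms [unfolded invertible_def]] by (auto simp: matrix_inv_def)

text \<open>A factor \<open>A\<close> turns the covariance form into an inner product, so that
  \<open>adjoint A\<close> applied to a standard Gaussian vector has this covariance. The choice
  \<delta> = 0 gives the multinomial limit, \<delta> = 1 / \<rho> the limit with noise. Rescaling by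
  the square root of the diagonal reduces the form to the identity minus
  \<open>u u\<^sup>T\<close>.\<close>

lemma covariance_factor:
  fixes p :: "real^'n"
  assumes p: "p \<in> positive_prob_vectors" and \<delta>: "\<delta> \<ge> 0"
  obtains A :: "real^'n \<Rightarrow> real^'n" where "linear A"
    "\<And>s t. A s \<bullet> A t = (\<Sum>k\<in>UNIV. (p $ k + \<delta>) * s $ k * t $ k) - (p \<bullet> s) * (p \<bullet> t)"
proof -
  define u :: "real^'n" where "u = (\<chi> k. p $ k / sqrt (p $ k + \<delta>))"
  define v :: "real^'n \<Rightarrow> real^'n" where "v t = (\<chi> k. sqrt (p $ k + \<delta>) * t $ k)" for t
  \<comment> \<open>With this \<open>c\<close>, the matrix \<open>I - c u u\<^sup>T\<close> is a square root of \<open>I - u u\<^sup>T\<close>.\<close>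
  define c where "c = 1 / (1 + sqrt (1 - u \<bullet> u))"
  define A where "A t = v t - (c * (u \<bullet> v t)) *\<^sub>R u" for t
  have pos: "p $ k > 0" for k
    using p by (simp add: positive_prob_vectors_def)
  then have pos': "p $ k + \<delta> > 0" for k
    using \<delta> add_pos_nonneg by blast
  \<comment> \<open>This bound makes the root in \<open>c\<close> real; it is an equality for
    \<delta> = 0, the singular case.\<close>
  have uu: "u \<bullet> u \<le> 1"
  proof -
    have "u \<bullet> u = (\<Sum>k\<in>UNIV. (p $ k)\<^sup>2 / (p $ k + \<delta>))"
      using pos' by (simp add: u_def inner_vec_def power2_eq_square less_imp_le)
    also have "\<dots> \<le> (\<Sum>k\<in>UNIV. p $ k)"
      using pos pos' \<delta> by (intro sum_mono) (simp add: divide_le_eq power2_eq_square less_imp_le)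
    finally show ?thesis
      using p by (simp add: positive_prob_vectors_def)
  qed
  \<comment> \<open>With \<open>q\<close> the defining property of \<open>c\<close> becomes the
    polynomial relation c (1 + q) = 1, from which the required identity is pure algebra.\<close>
  define q where "q = sqrt (1 - u \<bullet> u)"
  have q: "q \<ge> 0" "u \<bullet> u = 1 - q\<^sup>2"
    using uu by (simp_all add: q_def)
  then have "c * (1 + q) = 1"
    by (simp add: c_def q_def [symmetric])
  then have c: "2 * c - c\<^sup>2 * (u \<bullet> u) = 1"
    unfolding q(2) by algebra
  have uv: "u \<bullet> v t = p \<bullet> t" for t
    using pos' by (simp add: u_def v_def inner_vec_def) (metis less_irrefl)
  have vv: "v s \<bullet> v t = (\<Sum>k\<in>UNIV. (p $ k + \<delta>) * s $ k * t $ k)" for s t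
    unfolding v_def inner_vec_def
  proof (intro sum.cong refl)
    fix k
    have "sqrt (p $ k + \<delta>) * sqrt (p $ k + \<delta>) = p $ k + \<delta>"
      using pos' [of k] by simp
    then show "(\<chi> k. sqrt (p $ k + \<delta>) * s $ k) $ k \<bullet> (\<chi> k. sqrt (p $ k + \<delta>) * t $ k) $ k = (p $ k + \<delta>) * s $ k * t $ k"
      by (simp add: algebra_simps)
  qed
  have lin_v: "linear v"
    by (rule linearI) (simp_all add: v_def vec_eq_iff algebra_simps)
  have "linear A"
    by (rule linearI) (simp_all add: A_def linear_add [OF lin_v] linear_scale [OF lin_v] algebra_simps inner_add_right)
  moreover have "A s \<bullet> A t = (\<Sum>k\<in>UNIV. (p $ k + \<delta>) * s $ k * t $ k) - (p \<bullet> s) * (p \<bullet> t)" for s t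
  proof -
    have "A s \<bullet> A t = v s \<bullet> v t - (2 * c - c\<^sup>2 * (u \<bullet> u)) * ((u \<bullet> v s) * (u \<bullet> v t))"
      by (simp add: A_def inner_diff_left inner_diff_right inner_commute [of "v s" u] algebra_simps power2_eq_square)
    then show ?thesis
      by (simp add: c uv vv)
  qed
  ultimately show ?thesis by (rule that)
qed

lemma covariance_mult_vector:
  fixes p :: "real^'n"
  shows "((diag_matrix p - outer_product p p + \<delta> *\<^sub>R mat 1) *v t) $ k = (p $ k + \<delta>) * t $ k - p $ k * (p \<bullet> t)"
proof -
  have "((diag_matrix p - outer_product p p + \<delta> *\<^sub>R mat 1) *v t) $ k =
      (\<Sum>j\<in>UNIV. (if k = j then (p $ k + \<delta>) * t $ j else 0) - p $ k * (p $ j * t $ j))"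
    unfolding matrix_vector_mult_def diag_matrix_def outer_product_def mat_def
    by (simp add: algebra_simps if_distrib [where f = "\<lambda>x. _ * x"] cong: if_cong)
       (intro sum.cong refl, auto simp: algebra_simps)
  also have "\<dots> = (p $ k + \<delta>) * t $ k - p $ k * (p \<bullet> t)"
    by (simp add: sum_subtractf inner_vec_def sum_distrib_left)
  finally show ?thesis .
qed

lemma inner_covariance:
  fixes p :: "real^'n"
  shows "s \<bullet> ((diag_matrix p - outer_product p p + \<delta> *\<^sub>R mat 1) *v t) =
    (\<Sum>k\<in>UNIV. (p $ k + \<delta>) * s $ k * t $ k) - (p \<bullet> s) * (p \<bullet> t)"
  unfolding inner_vec_def [of s] covariance_mult_vector
  by (simp add: right_diff_distrib sum_subtractf sum_distrib_right sum_distrib_left inner_vec_def [of p s] mult_ac)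

lemma product_table_positive:
  assumes "a \<in> positive_prob_vectors" "b \<in> positive_prob_vectors"
  shows "product_table a b \<in> positive_prob_vectors"
proof -
  have "(\<Sum>k\<in>UNIV. a $ fst k * b $ snd k) = (\<Sum>i\<in>UNIV. a $ i) * (\<Sum>j\<in>UNIV. b $ j)"
    unfolding UNIV_Times_UNIV [symmetric] by (simp add: sum_product sum.cartesian_product split_beta)
  then show ?thesis
    using assms by (simp add: positive_prob_vectors_def product_table_def)
qed

lemma centering_mult_vector: "centering_matrix *v y = y - ((1 \<bullet> y) / real CARD('n)) *\<^sub>R (1 :: real^'n)"
proof -
  have "outer_product 1 1 *v y = (1 \<bullet> y) *\<^sub>R (1 :: real^'n)"
    by (simp add: outer_product_def matrix_vector_mult_def vec_eq_iff inner_vec_def)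
  then show ?thesis
    by (simp add: centering_matrix_def matrix_vector_mult_diff_rdistrib scaleR_matrix_vector_assoc [symmetric])
qed

lemma inner_centering_commute: "x \<bullet> (centering_matrix *v y) = (centering_matrix *v x) \<bullet> y"
  by (simp add: centering_mult_vector inner_diff_left inner_diff_right inner_commute)

lemma centering_quadratic_form:
  "y \<bullet> ((centering_matrix ** E ** centering_matrix) *v y) =
    (centering_matrix *v y) \<bullet> (E *v (centering_matrix *v y))"
  by (simp add: matrix_vector_mul_assoc [symmetric] inner_centering_commute)

section \<open>The tangent space of the independence model and the limit covariance\<close>

text \<open>The image of the differential of \<open>product_table\<close> at (a, b) on directions
  that preserve coordinate sums.\<close>

definition tangent_space :: "real^'r \<Rightarrow> real^'c \<Rightarrow> (real^('r::finite \<times> 'c::finite)) set" where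
  "tangent_space a b = {product_table g b + product_table a h | g h. 1 \<bullet> g = 0 \<and> 1 \<bullet> h = 0}"

lemma inner_1_eq_sum: "1 \<bullet> (x :: real^'n) = (\<Sum>k\<in>UNIV. x $ k)"
  by (simp add: inner_vec_def)

lemma sum_UNIV_prod: "(\<Sum>k\<in>UNIV. f k) = (\<Sum>i\<in>(UNIV :: 'a::finite set). \<Sum>j\<in>(UNIV :: 'b::finite set). f (i, j))"
  unfolding UNIV_Times_UNIV [symmetric] by (simp add: sum.cartesian_product)

lemma inner_1_product_table: "1 \<bullet> product_table a b = (1 \<bullet> a) * (1 \<bullet> b)"
  by (simp add: inner_1_eq_sum product_table_def sum_UNIV_prod sum_product)

lemma tangent_space_sum_0: "\<tau> \<in> tangent_space a b \<Longrightarrow> 1 \<bullet> \<tau> = 0"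
  by (auto simp: tangent_space_def inner_add_right inner_1_product_table)

text \<open>The parametrisation by (g, h) is injective: as \<open>a\<close> and \<open>b\<close> sum
  to one and \<open>g\<close> and \<open>h\<close> to zero, the row sums of the table return
  \<open>g\<close> and its column sums return \<open>h\<close>.\<close>

lemma
  fixes a :: "real^'r::finite" and b :: "real^'c::finite"
  assumes a: "1 \<bullet> a = 1" and b: "1 \<bullet> b = 1"
  shows subspace_tangent_space: "subspace (tangent_space a b)"
    and dim_tangent_space: "dim (tangent_space a b) = (CARD('r) - 1) + (CARD('c) - 1)"
proof -
  define \<Lambda> where "\<Lambda> = (\<lambda>(g :: real^'r, h :: real^'c). product_table g b + product_table a h)"
  define H where "H = {g :: real^'r. 1 \<bullet> g = 0} \<times> {h :: real^'c. 1 \<bullet> h = 0}"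
  have lin: "linear \<Lambda>"
    by (rule linearI) (auto simp: \<Lambda>_def product_table_def vec_eq_iff algebra_simps)
  have H: "subspace H"
    unfolding H_def by (intro subspace_Times subspace_hyperplane)
  have eq: "tangent_space a b = \<Lambda> ` H"
    by (force simp: tangent_space_def \<Lambda>_def H_def)
  show "subspace (tangent_space a b)"
    unfolding eq by (intro linear_subspace_image lin H)
  have "inj_on \<Lambda> H"
  proof (subst linear_injective_on_subspace_0 [OF lin H], safe)
    fix g :: "real^'r" and h :: "real^'c"
    assume gh: "(g, h) \<in> H" and 0: "\<Lambda> (g, h) = 0"
    then have k: "g $ i * b $ j + a $ i * h $ j = 0" for i j
      by (auto simp: \<Lambda>_def product_table_def vec_eq_iff)
    have "(\<Sum>j\<in>UNIV. g $ i * b $ j + a $ i * h $ j) = 0" "(\<Sum>i\<in>UNIV. g $ i * b $ j + a $ i * h $ j) = 0" for i j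
      by (simp_all add: k)
    then have "g $ i * (1 \<bullet> b) + a $ i * (1 \<bullet> h) = 0" "(1 \<bullet> g) * b $ j + (1 \<bullet> a) * h $ j = 0" for i j
      by (simp_all add: inner_1_eq_sum sum.distrib sum_distrib_left sum_distrib_right)
    then have "g $ i = 0" "h $ j = 0" for i j
      using gh a b by (simp_all add: H_def)
    then show "(g, h) = 0"
      by (simp add: vec_eq_iff zero_prod_def)
  qed
  then have "dim (tangent_space a b) = dim H"
    unfolding eq using lin H by (intro dim_image_eq) (simp_all add: span_eq_iff [THEN iffD2])
  also have "\<dots> = (CARD('r) - 1) + (CARD('c) - 1)"
    unfolding H_def by (subst dim_Times) (simp_all add: subspace_hyperplane dim_hyperplane)
  finally show "dim (tangent_space a b) = (CARD('r) - 1) + (CARD('c) - 1)" .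
qed

text \<open>The factor for \<delta> = 0 shows that the multinomial part is positive semidefinite;
  adding a positive multiple of the identity leaves no kernel.\<close>

lemma invertible_covariance:
  fixes p :: "real^'n"
  assumes p: "p \<in> positive_prob_vectors" and \<delta>: "\<delta> > 0"
  shows "invertible (diag_matrix p - outer_product p p + \<delta> *\<^sub>R mat 1)" (is "invertible ?\<Sigma>")
proof -
  obtain A :: "real^'n \<Rightarrow> real^'n" where
    A: "A s \<bullet> A t = (\<Sum>k\<in>UNIV. (p $ k + 0) * s $ k * t $ k) - (p \<bullet> s) * (p \<bullet> t)" for s t
    by (rule covariance_factor [OF p order_refl]) blast
  have "x = 0" if "?\<Sigma> *v x = 0" for x
  proof -
    have "0 = x \<bullet> (?\<Sigma> *v x)" using that by simp
    also have "\<dots> = A x \<bullet> A x + \<delta> * (x \<bullet> x)"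
      unfolding inner_covariance A by (simp add: inner_vec_def sum_distrib_left algebra_simps sum.distrib)
    finally show "x = 0"
      using \<delta> by (smt (verit) inner_eq_zero_iff inner_ge_zero mult_nonneg_nonneg mult_eq_0_iff)
  qed
  then show ?thesis
    using matrix_left_invertible_ker invertible_left_inverse by blast
qed

text \<open>In the coordinates given by \<open>R\<close> the covariance form becomes the standard inner product, and the
  minimum over the tangent space is the squared norm of the projection to the orthogonal complement of
  the image of the tangent space and the constant tables.\<close>

lemma limit_statistic:
  fixes a :: "real^'r::finite" and b :: "real^'c::finite" and \<delta> :: real
  defines "p \<equiv> product_table a b"
  defines "\<Sigma> \<equiv> diag_matrix p - outer_product p p + \<delta> *\<^sub>R mat 1"
  assumes a: "a \<in> positive_prob_vectors" and b: "b \<in> positive_prob_vectors" and \<delta>: "\<delta> > 0"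
  obtains A R :: "real^('r \<times> 'c) \<Rightarrow> real^('r \<times> 'c)" and B :: "(real^('r \<times> 'c)) set" where
    "linear A" "linear R" "inj R"
    "\<And>s t. A s \<bullet> A t = (\<Sum>k\<in>UNIV. (p $ k + \<delta>) * s $ k * t $ k) - (p \<bullet> s) * (p \<bullet> t)"
    "\<And>t. norm (A (adjoint R t)) = norm t"
    "\<And>v. v \<bullet> (matrix_inv \<Sigma> *v v) = (norm (R v))\<^sup>2"
    "finite B" "pairwise orthogonal B" "\<And>f. f \<in> B \<Longrightarrow> norm f = 1"
    "card B = (CARD('r) - 1) * (CARD('c) - 1)"
    "\<And>x \<tau>. \<tau> \<in> tangent_space a b \<Longrightarrow> (\<Sum>f\<in>B. (f \<bullet> R x)\<^sup>2) \<le> (norm (R (centering_matrix *v (x - \<tau>))))\<^sup>2"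
    "\<And>x. \<exists>\<tau>\<in>tangent_space a b. (norm (R (centering_matrix *v (x - \<tau>))))\<^sup>2 = (\<Sum>f\<in>B. (f \<bullet> R x)\<^sup>2)"
proof -
  have p: "p \<in> positive_prob_vectors"
    using a b by (simp add: p_def product_table_positive)
  have sums: "1 \<bullet> a = 1" "1 \<bullet> b = 1" "1 \<bullet> p = 1"
    using a b p by (simp_all add: inner_1_eq_sum positive_prob_vectors_def)
  obtain A :: "real^('r \<times> 'c) \<Rightarrow> real^('r \<times> 'c)" where lin_A: "linear A" and
    A: "A s \<bullet> A t = (\<Sum>k\<in>UNIV. (p $ k + \<delta>) * s $ k * t $ k) - (p \<bullet> s) * (p \<bullet> t)" for s t
    by (rule covariance_factor [OF p less_imp_le [OF \<delta>]]) blast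
  have A': "A s \<bullet> A t = s \<bullet> (\<Sigma> *v t)" for s t
    by (simp add: A \<Sigma>_def inner_covariance)
  define S where "S = adjoint A"
  have lin_S: "linear S"
    unfolding S_def using lin_A by (rule adjoint_linear)
  have S: "s \<bullet> S t = A s \<bullet> t" for s t
    unfolding S_def using adjoint_works [OF lin_A] .
  have SA: "S (A t) = \<Sigma> *v t" for t
    by (rule vector_eq_rdot [THEN iffD1]) (simp add: S A' inner_commute [of "S _"] inner_commute [of "_ *v _"])
  have inv: "invertible \<Sigma>"
    unfolding \<Sigma>_def using p \<delta> by (rule invertible_covariance)
  then have \<Sigma>_inv: "\<Sigma> *v (matrix_inv \<Sigma> *v v) = v" "matrix_inv \<Sigma> *v (\<Sigma> *v v) = v" for v
    by (simp_all add: matrix_vector_mul_assoc matrix_inv_mult)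
  \<comment> \<open>Since \<Sigma> is \<open>adjoint A\<close> composed with \<open>A\<close>, this
    is the inverse of \<open>adjoint A\<close>. It whitens: a vector with covariance \<Sigma> is
    sent to one with identity covariance.\<close>
  define R where "R v = A (matrix_inv \<Sigma> *v v)" for v
  have lin_R: "linear R"
    unfolding R_def using linear_compose [OF matrix_vector_mul_linear lin_A] by (simp add: o_def)
  have SR: "S (R v) = v" for v
    by (simp add: R_def SA \<Sigma>_inv)
  have inj_R: "inj R"
    by (metis SR injI)
  then have surj_R: "surj R"
    using lin_R linear_injective_imp_surjective by blast
  have RS: "R (S v) = v" for v
    using surj_R SR by (metis surjD)
  have RR: "v \<bullet> (matrix_inv \<Sigma> *v v) = (norm (R v))\<^sup>2" for v
    by (simp add: power2_norm_eq_inner R_def A' \<Sigma>_inv inner_commute)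
  have AR: "A (adjoint R t) = t" for t
  proof (rule vector_eq_rdot [THEN iffD1], rule allI)
    fix s
    show "A (adjoint R t) \<bullet> s = t \<bullet> s"
      by (simp add: S [symmetric] adjoint_works [OF lin_R, symmetric] inner_commute [of _ "S s"])
         (simp add: adjoint_works [OF lin_R] RS inner_commute)
  qed
  \<comment> \<open>The eigenvector property of constant tables. It will show that the optimal
    residual has sum zero.\<close>
  have \<Sigma>1: "\<Sigma> *v 1 = \<delta> *\<^sub>R 1"
    using sums(3) by (simp add: \<Sigma>_def vec_eq_iff covariance_mult_vector inner_commute)
  have A1: "A 1 = \<delta> *\<^sub>R R 1"
    using \<Sigma>_inv(2) [of 1] by (simp add: R_def \<Sigma>1 linear_scale [OF matrix_vector_mul_linear] linear_scale [OF lin_A, symmetric])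
  let ?T = "tangent_space a b"
  have T: "subspace ?T" and dim_T: "dim ?T = (CARD('r) - 1) + (CARD('c) - 1)"
    using sums by (simp_all add: subspace_tangent_space dim_tangent_space)
  \<comment> \<open>Centring alters a table by a constant one, so constant tables join the
    directions that the statistic ignores.\<close>
  define L where "L = span (insert 1 ?T)"
  have L_E: "\<exists>\<tau>\<in>?T. \<exists>k. l = \<tau> + k *\<^sub>R 1" if l: "l \<in> L" for l
  proof -
    obtain k where "l - k *\<^sub>R 1 \<in> ?T"
      using l span_insert [of 1 ?T] span_eq_iff [THEN iffD2, OF T] unfolding L_def by auto
    then show ?thesis by force
  qed
  have L_I: "\<tau> + k *\<^sub>R 1 \<in> L" if "\<tau> \<in> ?T" for \<tau> k
    unfolding L_def using that by (intro span_add span_scale) (auto intro: span_base)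
  have "(1 :: real^('r \<times> 'c)) \<notin> ?T"
    using tangent_space_sum_0 [of 1 a b] by (auto simp: inner_1_eq_sum)
  then have dim_L: "dim L = (CARD('r) - 1) + (CARD('c) - 1) + 1"
    using dim_T T by (simp add: L_def dim_insert span_eq_iff [THEN iffD2])
  have sub_L: "subspace L" by (simp add: L_def)
  define N where "N = {y. \<forall>x\<in>R ` L. orthogonal x y}"
  have sub_RL: "subspace (R ` L)"
    using lin_R sub_L by (rule linear_subspace_image)
  have "dim N + dim (R ` L) = dim (UNIV :: (real^('r \<times> 'c)) set)"
    using dim_subspace_orthogonal_to_vectors [OF sub_RL subspace_UNIV] by (simp add: N_def)
  moreover have "dim (R ` L) = dim L"
    using lin_R inj_R by (intro dim_image_eq) (auto intro: inj_on_subset)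
  ultimately have dim_N: "dim N = (CARD('r) - 1) * (CARD('c) - 1)"
  proof -
    assume 1: "dim N + dim (R ` L) = dim (UNIV :: (real^('r \<times> 'c)) set)" and 2: "dim (R ` L) = dim L"
    \<comment> \<open>Predecessors keep the count free of truncated subtraction: (r + 1) (c + 1) -
      (r + c + 1) = r c.\<close>
    obtain r c where rc: "CARD('r) = Suc r" "CARD('c) = Suc c"
      using gr0_implies_Suc [OF zero_less_card_finite] by meson
    from 1 2 dim_L have "dim N + (r + c + 1) = Suc r * Suc c"
      by (simp add: dim_UNIV card_prod rc)
    then show ?thesis by (simp add: rc)
  qed
  have sub_N: "subspace N"
    unfolding N_def by (rule subspace_orthogonal_to_vectors)
  obtain B where B: "B \<subseteq> N" "pairwise orthogonal B" "\<And>f. f \<in> B \<Longrightarrow> norm f = 1"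
      "independent B" "card B = dim N" "span B = N"
    using orthonormal_basis_subspace [OF sub_N] by metis
  have fin_B: "finite B"
    using B(4) by (rule independent_imp_finite)
  have B_orth: "f \<bullet> R l = 0" if "f \<in> B" "l \<in> L" for f l
    using that B(1) by (auto simp: N_def orthogonal_def inner_commute)
  have centering_diff: "x - centering_matrix *v (x - \<tau>) \<in> L" if "\<tau> \<in> ?T" for x \<tau>
    using L_I [OF that, of "(1 \<bullet> (x - \<tau>)) / real CARD('r \<times> 'c)"] by (simp add: centering_mult_vector)
  have expansion: "(norm z)\<^sup>2 = (\<Sum>f\<in>B. (f \<bullet> z)\<^sup>2)" if z: "z \<in> N" for z
  proof -
    obtain u where u: "z = (\<Sum>f\<in>B. u f *\<^sub>R f)"
      using z B(6) span_finite [OF fin_B] by auto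
    have "f \<bullet> z = u f" if "f \<in> B" for f
    proof -
      have "f \<bullet> z = (\<Sum>g\<in>B. if g = f then u f else 0)"
        unfolding u inner_sum_right
      proof (intro sum.cong refl)
        fix g assume "g \<in> B"
        then show "f \<bullet> u g *\<^sub>R g = (if g = f then u f else 0)"
          using B(2,3) that by (auto simp: pairwise_def orthogonal_def power2_norm_eq_inner [symmetric])
      qed
      then show ?thesis using fin_B that by simp
    qed
    moreover have "(norm z)\<^sup>2 = (\<Sum>f\<in>B. (u f)\<^sup>2)"
      unfolding u using B(2,3) fin_B by (intro norm_sum_orthonormal_power2) (auto simp: pairwise_def)
    ultimately show ?thesis by simp
  qed
  \<comment> \<open>The frame \<open>B\<close> does not see \<open>L\<close>, so \<open>x\<close>
    may be traded for its centred residual; projecting that residual to \<open>N\<close> can only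
    shorten it.\<close>
  have lower: "(\<Sum>f\<in>B. (f \<bullet> R x)\<^sup>2) \<le> (norm (R (centering_matrix *v (x - \<tau>))))\<^sup>2" if "\<tau> \<in> ?T" for x \<tau>
  proof -
    define v where "v = R (centering_matrix *v (x - \<tau>))"
    have "f \<bullet> R x = f \<bullet> v" if "f \<in> B" for f
      using B_orth [OF that centering_diff [OF \<open>\<tau> \<in> ?T\<close>, of x]]
      by (simp add: v_def linear_diff [OF lin_R] inner_diff_right)
    then have "(\<Sum>f\<in>B. (f \<bullet> R x)\<^sup>2) = (\<Sum>f\<in>B. (f \<bullet> v)\<^sup>2)"
      by simp
    obtain y z where yz: "y \<in> span N" "\<And>w. w \<in> span N \<Longrightarrow> orthogonal z w" "v = y + z"
      by (rule orthogonal_subspace_decomp_exists [of N v]) blast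
    have y: "y \<in> N"
      using yz(1) sub_N by (simp add: span_eq_iff [THEN iffD2])
    have "f \<bullet> v = f \<bullet> y" if "f \<in> B" for f
      using yz(2) [of f] yz(3) that B(1) by (auto simp: inner_add_right orthogonal_def inner_commute span_base)
    then have "(\<Sum>f\<in>B. (f \<bullet> v)\<^sup>2) = (norm y)\<^sup>2"
      by (simp add: expansion [OF y])
    also have "\<dots> \<le> (norm v)\<^sup>2"
      using yz(2) [OF yz(1)] unfolding yz(3)
      by (subst norm_add_Pythagorean) (simp_all add: orthogonal_commute)
    finally show ?thesis
      using \<open>(\<Sum>f\<in>B. (f \<bullet> R x)\<^sup>2) = (\<Sum>f\<in>B. (f \<bullet> v)\<^sup>2)\<close> by (simp add: v_def)
  qed
  have attained: "\<exists>\<tau>\<in>?T. (norm (R (centering_matrix *v (x - \<tau>))))\<^sup>2 = (\<Sum>f\<in>B. (f \<bullet> R x)\<^sup>2)" for x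
  proof -
    obtain y z where yz: "y \<in> span (R ` L)" "\<And>w. w \<in> span (R ` L) \<Longrightarrow> orthogonal z w" "R x = y + z"
      by (rule orthogonal_subspace_decomp_exists [of "R ` L" "R x"]) blast
    have "y \<in> R ` L"
      using yz(1) sub_RL by (simp add: span_eq_iff [THEN iffD2])
    then obtain l where l: "l \<in> L" "y = R l" by auto
    obtain \<tau> k where \<tau>: "\<tau> \<in> ?T" "l = \<tau> + k *\<^sub>R 1"
      using L_E [OF l(1)] by auto
    have "orthogonal w z" if "w \<in> R ` L" for w
      using yz(2) [OF span_base [OF that]] by (rule orthogonal_commute [THEN iffD1])
    then have z: "z \<in> N"
      by (simp add: N_def)
    have "x - l = S z"
      using SR [of "x - l"] yz(3) l(2) by (simp add: linear_diff [OF lin_R])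
    then have x: "x - \<tau> = S z + k *\<^sub>R 1"
      by (simp add: \<tau>(2) algebra_simps)
    have "1 \<in> L"
      using L_I [of 0 1] T by (simp add: subspace_0)
    \<comment> \<open>By the eigenvector property this number is a multiple of the inner product of
      \<open>z\<close> with \<open>R 1\<close>, which vanishes. Hence the residual is already
      centred up to the explicit constant, and the tangent part \<tau> of the projection attains the
      bound.\<close>
    then have "1 \<bullet> S z = 0"
      using z by (auto simp: S A1 N_def orthogonal_def)
    then have "centering_matrix *v (x - \<tau>) = S z"
      by (simp add: x centering_mult_vector inner_add_right) (simp add: inner_1_eq_sum)
    then have "R (centering_matrix *v (x - \<tau>)) = z"
      by (simp add: RS)
    moreover have "f \<bullet> R x = f \<bullet> z" if "f \<in> B" for f
      using B_orth [OF that l(1)] by (simp add: yz(3) l(2) inner_add_right)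
    ultimately show ?thesis
      using \<tau>(1) expansion [OF z] by auto
  qed
  show ?thesis
    by (rule that [of A R B]) (use lin_A lin_R inj_R A AR RR fin_B B dim_N lower attained in auto)
qed

section \<open>Continuity of the inverse and behaviour of the estimated covariance\<close>

text \<open>Cramer's rule writes each entry as a quotient of determinants, so that continuity of
  inversion follows from continuity of \<open>det\<close>.\<close>

lemma matrix_inv_component:
  fixes A :: "real^'n^'n"
  assumes "invertible A"
  shows "matrix_inv A $ k $ j = det (\<chi> i l. if l = k then axis j 1 $ i else A $ i $ l) / det A"
proof -
  have "A *v (matrix_inv A *v axis j 1) = axis j 1"
    using assms by (simp add: matrix_vector_mul_assoc matrix_inv_mult)
  then have "matrix_inv A *v axis j 1 = (\<chi> k. det (\<chi> i l. if l = k then axis j 1 $ i else A $ i $ l) / det A)"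
    using assms by (subst (asm) cramer) (simp_all add: invertible_det_nz)
  then have "(matrix_inv A *v axis j 1) $ k = det (\<chi> i l. if l = k then axis j 1 $ i else A $ i $ l) / det A"
    by simp
  then show ?thesis
    by (simp add: matrix_vector_mul_component inner_axis)
qed

lemma tendsto_det:
  fixes f :: "'a \<Rightarrow> real^'n^'n"
  assumes "(f \<longlongrightarrow> A) F"
  shows "((\<lambda>x. det (f x)) \<longlongrightarrow> det A) F"
  unfolding det_def by (intro tendsto_intros assms)

lemma tendsto_matrix_inv:
  fixes f :: "'a \<Rightarrow> real^'n^'n"
  assumes f: "(f \<longlongrightarrow> A) F" and A: "invertible A"
  shows "((\<lambda>x. matrix_inv (f x)) \<longlongrightarrow> matrix_inv A) F" "eventually (\<lambda>x. invertible (f x)) F"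
proof -
  have det: "((\<lambda>x. det (f x)) \<longlongrightarrow> det A) F"
    using f by (rule tendsto_det)
  have nz: "det A \<noteq> 0"
    using A by (simp add: invertible_det_nz)
  show ev: "eventually (\<lambda>x. invertible (f x)) F"
    using tendsto_imp_eventually_ne [OF det nz] by (simp add: invertible_det_nz)
  show "((\<lambda>x. matrix_inv (f x)) \<longlongrightarrow> matrix_inv A) F"
  proof (intro vec_tendstoI)
    fix k j
    have "((\<lambda>x. det (\<chi> i l. if l = k then axis j 1 $ i else f x $ i $ l) / det (f x)) \<longlongrightarrow>
        det (\<chi> i l. if l = k then axis j 1 $ i else A $ i $ l) / det A) F"
      by (intro tendsto_divide tendsto_det det nz vec_tendstoI) (auto intro!: tendsto_intros f)
    then show "((\<lambda>x. matrix_inv (f x) $ k $ j) \<longlongrightarrow> matrix_inv A $ k $ j) F"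
      unfolding matrix_inv_component [OF A]
      by (rule Lim_transform_eventually) (use ev in \<open>eventually_elim, simp add: matrix_inv_component\<close>)
  qed
qed

lemma tendsto_matrix_vector_mult:
  fixes f :: "'a \<Rightarrow> real^'n^'m" and g :: "'a \<Rightarrow> real^'n"
  assumes "(f \<longlongrightarrow> A) F" "(g \<longlongrightarrow> x) F"
  shows "((\<lambda>t. f t *v g t) \<longlongrightarrow> A *v x) F"
  unfolding matrix_vector_mult_def by (intro vec_tendstoI) (auto intro!: tendsto_intros assms)

lemma continuous_on_product_table [continuous_intros]:
  assumes "continuous_on S f" "continuous_on S g"
  shows "continuous_on S (\<lambda>x. product_table (f x) (g x))"
  unfolding product_table_def by (intro continuous_intros continuous_on_vec_lambda assms)

lemma bounded_positive_prob_vectors: "bounded (positive_prob_vectors :: (real^'n) set)"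
  unfolding bounded_iff
proof (intro exI ballI)
  fix a :: "real^'n" assume a: "a \<in> positive_prob_vectors"
  have "norm a \<le> (\<Sum>i\<in>UNIV. \<bar>a $ i\<bar>)"
    by (rule norm_le_l1_cart)
  also have "\<dots> = 1"
    using a by (simp add: positive_prob_vectors_def less_imp_le)
  finally show "norm a \<le> 1" .
qed

text \<open>The estimated covariance may be indefinite, so nonnegativity cannot serve as a bound.
  Its inverse is fixed while the vectors vary, hence the statistic extends continuously to the
  compact closure of the parameter set.\<close>

lemma bdd_below_private_statistic:
  fixes h z :: "real^('r::finite \<times> 'c::finite)"
  shows "bdd_below ((\<lambda>(a, b). private_statistic \<rho> n h z a b) ` (positive_prob_vectors \<times> positive_prob_vectors))"
proof -
  let ?P = "positive_prob_vectors \<times> positive_prob_vectors :: ((real^'r) \<times> (real^'c)) set"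
  have cont: "continuous_on UNIV (\<lambda>(a, b). private_statistic \<rho> n h z a b)"
    unfolding private_statistic_def Let_def split_beta
    by (intro continuous_intros continuous_on_compose2 [OF matrix_vector_mult_linear_continuous_on])
       (auto intro!: continuous_intros)
  have "compact (closure ?P)"
    by (simp add: compact_closure bounded_Times bounded_positive_prob_vectors)
  then have "compact ((\<lambda>(a, b). private_statistic \<rho> n h z a b) ` closure ?P)"
    using cont by (intro compact_continuous_image) (auto intro: continuous_on_subset)
  then show ?thesis
    by (meson bounded_imp_bdd_below bounded_subset compact_imp_bounded image_mono closure_subset)
qed

text \<open>Strict positivity is an open condition, so small moves of sum zero remain admissible.
  They supply the competitors for the upper bound on the infimum.\<close>

lemma positive_prob_vectors_perturb:
  fixes a :: "real^'n" and c :: "nat \<Rightarrow> real"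
  assumes a: "a \<in> positive_prob_vectors" and h: "1 \<bullet> h = 0" and c: "c \<longlonglongrightarrow> 0"
  shows "eventually (\<lambda>n. a + c n *\<^sub>R h \<in> positive_prob_vectors) sequentially"
proof -
  have "(\<lambda>n. (a + c n *\<^sub>R h) $ i) \<longlonglongrightarrow> (a + 0 *\<^sub>R h) $ i" for i
    by (intro tendsto_intros c)
  moreover have "(a + 0 *\<^sub>R h) $ i > 0" for i
    using a by (simp add: positive_prob_vectors_def)
  ultimately have "eventually (\<lambda>n. (a + c n *\<^sub>R h) $ i > 0) sequentially" for i
    by (rule order_tendstoD(1))
  then have "eventually (\<lambda>n. \<forall>i. (a + c n *\<^sub>R h) $ i > 0) sequentially"
    by (rule eventually_all_finite)
  then show ?thesis
    by eventually_elim
       (use a h in \<open>simp add: positive_prob_vectors_def inner_1_eq_sum sum.distrib flip: sum_distrib_left\<close>)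
qed

text \<open>Only \<open>h + z\<close> and the noisy size enter the statistic, so on tables \<open>h\<close> of total \<open>n\<close> it is a
  function of the normalised table \<open>x\<close>.\<close>

lemma min_private_statistic_cong:
  assumes "h + z = h' + z'" "noisy_size n z = noisy_size n z'"
  shows "min_private_statistic d \<rho> n h z = min_private_statistic d \<rho> n h' z'"
proof -
  have "h $ k + z $ k = h' $ k + z' $ k" for k
    using arg_cong [OF assms(1), of "\<lambda>x. x $ k"] by simp
  then show ?thesis
    using assms unfolding min_private_statistic_def private_statistic_def covariance_estimate_def
      row_estimate_def column_estimate_def by simp
qed

text \<open>For fixed \<open>x\<close> the deviation has order sqrt n against counts of order n, so
  the estimated margins are those of \<open>p\<close> up to order 1 / sqrt n.\<close>

lemma covariance_estimate_tendsto:
  fixes a :: "real^'r::finite" and b :: "real^'c::finite" and x :: "real^('r \<times> 'c)"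
  assumes a: "a \<in> positive_prob_vectors" and b: "b \<in> positive_prob_vectors"
  defines "p \<equiv> product_table a b"
  shows "(\<lambda>n. covariance_estimate \<rho> n (real n *\<^sub>R p) (sqrt n *\<^sub>R x)) \<longlonglongrightarrow>
      diag_matrix p - outer_product p p + (1 / \<rho>) *\<^sub>R mat 1" (is "?M \<longlonglongrightarrow> _")
    and "eventually (\<lambda>n. noisy_size n (sqrt n *\<^sub>R x) \<noteq> 0) sequentially"
proof -
  have sums: "(\<Sum>i\<in>UNIV. a $ i) = 1" "(\<Sum>j\<in>UNIV. b $ j) = 1"
    using a b by (simp_all add: positive_prob_vectors_def)
  define e where "e n = 1 / sqrt (real n)" for n
  have e: "e \<longlonglongrightarrow> 0"
    unfolding e_def
    by (intro real_tendsto_divide_at_top [where c = 1] tendsto_const filterlim_compose [OF sqrt_at_top filterlim_real_sequentially])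
  have ne: "real n * e n = sqrt (real n)" for n
    by (simp add: e_def real_div_sqrt)
  have size: "noisy_size n (sqrt n *\<^sub>R x) = real n * (1 + e n * (1 \<bullet> x))" for n
    by (simp add: noisy_size_def ne distrib_left mult.assoc [symmetric] inner_1_eq_sum flip: sum_distrib_left)
  have lim_1: "(\<lambda>n. 1 + e n * (1 \<bullet> x)) \<longlonglongrightarrow> 1 + 0 * (1 \<bullet> x)"
    by (intro tendsto_intros e)
  then have "eventually (\<lambda>n. 1 + e n * (1 \<bullet> x) \<noteq> 0) sequentially"
    by (rule tendsto_imp_eventually_ne) simp
  then show "eventually (\<lambda>n. noisy_size n (sqrt n *\<^sub>R x) \<noteq> 0) sequentially"
    using eventually_gt_at_top [of 0] by eventually_elim (simp add: size)
  have quotient: "1 / noisy_size n (sqrt n *\<^sub>R x) * (real n * c + sqrt n * y) = (c + e n * y) / (1 + e n * (1 \<bullet> x))"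
    if "n > 0" for n c y
  proof -
    have "real n * c + sqrt n * y = real n * (c + e n * y)"
      by (simp add: ne distrib_left mult.assoc [symmetric])
    then show ?thesis
      using that by (simp add: size)
  qed
  have row: "(\<lambda>n. row_estimate n (real n *\<^sub>R p) (sqrt n *\<^sub>R x)) \<longlonglongrightarrow> a"
  proof (rule vec_tendstoI)
    fix i
    define y where "y = (\<Sum>j\<in>UNIV. x $ (i, j))"
    have lim: "(\<lambda>n. (a $ i + e n * y) / (1 + e n * (1 \<bullet> x))) \<longlonglongrightarrow> (a $ i + 0 * y) / (1 + 0 * (1 \<bullet> x))"
      by (intro tendsto_intros e) simp
    have "row_estimate n (real n *\<^sub>R p) (sqrt n *\<^sub>R x) $ i = (a $ i + e n * y) / (1 + e n * (1 \<bullet> x))" if "n > 0" for n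
    proof -
      have "(\<Sum>j\<in>UNIV. (real n *\<^sub>R p) $ (i, j) + (sqrt n *\<^sub>R x) $ (i, j)) = real n * a $ i + sqrt n * y"
        using sums by (simp add: y_def p_def product_table_def sum.distrib flip: sum_distrib_left mult.assoc)
      then show ?thesis
        using quotient [OF that] by (simp add: row_estimate_def)
    qed
    then have "eventually (\<lambda>n. (a $ i + e n * y) / (1 + e n * (1 \<bullet> x)) =
        row_estimate n (real n *\<^sub>R p) (sqrt n *\<^sub>R x) $ i) sequentially"
      by (intro eventually_sequentiallyI [of 1]) simp
    with lim show "(\<lambda>n. row_estimate n (real n *\<^sub>R p) (sqrt n *\<^sub>R x) $ i) \<longlonglongrightarrow> a $ i"
      using Lim_transform_eventually by fastforce
  qed
  have column: "(\<lambda>n. column_estimate n (real n *\<^sub>R p) (sqrt n *\<^sub>R x)) \<longlonglongrightarrow> b"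
  proof (rule vec_tendstoI)
    fix j
    define y where "y = (\<Sum>i\<in>UNIV. x $ (i, j))"
    have lim: "(\<lambda>n. (b $ j + e n * y) / (1 + e n * (1 \<bullet> x))) \<longlonglongrightarrow> (b $ j + 0 * y) / (1 + 0 * (1 \<bullet> x))"
      by (intro tendsto_intros e) simp
    have "column_estimate n (real n *\<^sub>R p) (sqrt n *\<^sub>R x) $ j = (b $ j + e n * y) / (1 + e n * (1 \<bullet> x))" if "n > 0" for n
    proof -
      have "(\<Sum>i\<in>UNIV. (real n *\<^sub>R p) $ (i, j) + (sqrt n *\<^sub>R x) $ (i, j)) = real n * b $ j + sqrt n * y"
        using sums by (simp add: y_def p_def product_table_def sum.distrib flip: sum_distrib_left sum_distrib_right mult.assoc)
      then show ?thesis
        using quotient [OF that] by (simp add: column_estimate_def)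
    qed
    then have "eventually (\<lambda>n. (b $ j + e n * y) / (1 + e n * (1 \<bullet> x)) =
        column_estimate n (real n *\<^sub>R p) (sqrt n *\<^sub>R x) $ j) sequentially"
      by (intro eventually_sequentiallyI [of 1]) simp
    with lim show "(\<lambda>n. column_estimate n (real n *\<^sub>R p) (sqrt n *\<^sub>R x) $ j) \<longlonglongrightarrow> b $ j"
      using Lim_transform_eventually by fastforce
  qed
  have "(\<lambda>n. product_table (row_estimate n (real n *\<^sub>R p) (sqrt n *\<^sub>R x)) (column_estimate n (real n *\<^sub>R p) (sqrt n *\<^sub>R x))) \<longlonglongrightarrow> p"
    unfolding p_def product_table_def
    by (intro vec_tendstoI) (auto intro!: tendsto_intros row [unfolded p_def product_table_def] column [unfolded p_def product_table_def])
  then show "?M \<longlonglongrightarrow> diag_matrix p - outer_product p p + (1 / \<rho>) *\<^sub>R mat 1"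
    unfolding covariance_estimate_def Let_def diag_matrix_def outer_product_def
    by (intro tendsto_add tendsto_diff tendsto_const vec_tendstoI) (auto intro!: tendsto_intros)
qed

section \<open>Pointwise convergence of the minimal statistic\<close>

lemma private_statistic_rescaled:
  assumes "n > 0"
  shows "private_statistic \<rho> n (real n *\<^sub>R p) (sqrt n *\<^sub>R x) a b =
    (let y = centering_matrix *v (x - sqrt n *\<^sub>R (product_table a b - p))
     in y \<bullet> (matrix_inv (covariance_estimate \<rho> n (real n *\<^sub>R p) (sqrt n *\<^sub>R x)) *v y))"
proof -
  define E where "E = centering_matrix ** matrix_inv (covariance_estimate \<rho> n (real n *\<^sub>R p) (sqrt n *\<^sub>R x)) ** centering_matrix"
  define y where "y = x - sqrt n *\<^sub>R (product_table a b - p)"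
  have "real n *\<^sub>R p + sqrt n *\<^sub>R x - real n *\<^sub>R product_table a b = sqrt n *\<^sub>R y"
    by (simp add: y_def algebra_simps)
  then have "private_statistic \<rho> n (real n *\<^sub>R p) (sqrt n *\<^sub>R x) a b =
      1 / real n * ((sqrt n *\<^sub>R y) \<bullet> (E *v (sqrt n *\<^sub>R y)))"
    by (simp add: private_statistic_def E_def)
  also have "\<dots> = y \<bullet> (E *v y)"
    using assms by (simp add: matrix_vector_mult_scaleR mult.assoc [symmetric])
  finally show ?thesis
    by (simp add: E_def centering_quadratic_form y_def Let_def)
qed

text \<open>The constant is a sum over entries because its convergence to zero follows at once from
  convergence of the matrix.\<close>

lemma abs_quadratic_form_le: "\<bar>v \<bullet> (E *v v)\<bar> \<le> (\<Sum>i\<in>UNIV. \<Sum>j\<in>UNIV. \<bar>E $ i $ j\<bar>) * (norm v)\<^sup>2"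
  for E :: "real^'n^'n"
proof -
  have "\<bar>v \<bullet> (E *v v)\<bar> \<le> norm v * norm (E *v v)"
    by (rule Cauchy_Schwarz_ineq2)
  also have "norm (E *v v) \<le> onorm ((*v) E) * norm v"
    by (intro onorm matrix_vector_mul_bounded_linear)
  also have "onorm ((*v) E) \<le> (\<Sum>i\<in>UNIV. \<Sum>j\<in>UNIV. \<bar>E $ i $ j\<bar>)"
    by (rule onorm_le_matrix_component_sum)
  finally show ?thesis
    by (simp add: power2_eq_square mult_left_mono mult_right_mono mult_ac)
qed

lemma product_table_diff:
  "product_table a b - product_table a' b' =
    product_table (a - a') b' + product_table a' (b - b') + product_table (a - a') (b - b')"
  by (simp add: product_table_def vec_eq_iff algebra_simps)

lemma product_table_scaleR:
  "product_table (c *\<^sub>R a) b = c *\<^sub>R product_table a b" "product_table a (c *\<^sub>R b) = c *\<^sub>R product_table a b"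
  by (simp_all add: product_table_def vec_eq_iff)

text \<open>The bilinear error term is negligible: a perturbation of bounded size has bounded margins.\<close>

lemma product_table_deviation_lower_bound:
  fixes a0 :: "real^'r::finite" and b0 :: "real^'c::finite" and R :: "real^('r \<times> 'c) \<Rightarrow> real^('r \<times> 'c)"
  assumes a0: "a0 \<in> positive_prob_vectors" and b0: "b0 \<in> positive_prob_vectors"
    and R: "linear R" "inj R"
    and m: "m \<ge> 0" "\<And>\<tau>. \<tau> \<in> tangent_space a0 b0 \<Longrightarrow> m \<le> norm (R (centering_matrix *v (x - \<tau>)))"
  obtains K where "\<And>a b s. a \<in> positive_prob_vectors \<Longrightarrow> b \<in> positive_prob_vectors \<Longrightarrow> s > 0 \<Longrightarrow>
     m - K / s \<le> norm (R (centering_matrix *v (x - s *\<^sub>R (product_table a b - product_table a0 b0))))"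
proof -
  define Q where "Q y = R (centering_matrix *v y)" for y
  have lin_Q: "linear Q"
    unfolding Q_def using linear_compose [OF matrix_vector_mul_linear R(1)] by (simp add: o_def)
  then have bounded_Q: "bounded_linear Q"
    by (simp add: linear_conv_bounded_linear)
  then have onorm_Q: "onorm Q \<ge> 0"
    by (rule onorm_pos_le)
  obtain \<mu> where \<mu>: "\<mu> > 0" "\<And>y. \<mu> * norm y \<le> norm (R y)"
    using linear_inj_bounded_below_pos [OF R] by blast
  \<comment> \<open>Bounds the deviation \<open>y\<close> whenever the residual is shorter than
    \<open>m\<close>; otherwise the claim is immediate.\<close>
  define K0 where "K0 = (m + norm (Q x)) / \<mu>"
  \<comment> \<open>The margins of a table with entries at most \<open>K0\<close> are at most rc
    times \<open>K0\<close>, a crude bound common to rows and columns; its square is then summed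
    over the rc cells.\<close>
  define K1 where "K1 = real CARD('r \<times> 'c) * (real CARD('r \<times> 'c) * K0)\<^sup>2"
  have K0: "K0 \<ge> 0"
    using m(1) \<mu>(1) by (simp add: K0_def)
  then have K1: "K1 \<ge> 0"
    by (simp add: K1_def)
  have "m - onorm Q * K1 / s \<le> norm (Q (x - s *\<^sub>R (product_table a b - product_table a0 b0)))"
    if a: "a \<in> positive_prob_vectors" and b: "b \<in> positive_prob_vectors" and s: "s > 0" for a b s
  proof -
    define \<alpha> where "\<alpha> = s *\<^sub>R (a - a0)"
    define \<beta> where "\<beta> = s *\<^sub>R (b - b0)"
    define \<tau> where "\<tau> = product_table \<alpha> b0 + product_table a0 \<beta>"
    define y where "y = s *\<^sub>R (product_table a b - product_table a0 b0)"
    have sums: "1 \<bullet> a = 1" "1 \<bullet> b = 1" "1 \<bullet> a0 = 1" "1 \<bullet> b0 = 1"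
      using a b a0 b0 by (simp_all add: positive_prob_vectors_def inner_1_eq_sum)
    have \<alpha>\<beta>: "1 \<bullet> \<alpha> = 0" "1 \<bullet> \<beta> = 0"
      by (simp_all add: \<alpha>_def \<beta>_def inner_diff_right sums)
    then have \<tau>: "\<tau> \<in> tangent_space a0 b0"
      by (auto simp: tangent_space_def \<tau>_def)
    \<comment> \<open>The model is bilinear, so the deviation is exactly a tangent vector plus one
      quadratic term of relative size 1 / s.\<close>
    have y: "y = \<tau> + (1 / s) *\<^sub>R product_table \<alpha> \<beta>"
      using s by (simp add: y_def \<tau>_def \<alpha>_def \<beta>_def product_table_diff product_table_scaleR scaleR_add_right)
    have "norm (Q (x - \<tau>)) \<le> norm (Q (x - y)) + norm ((1 / s) *\<^sub>R Q (product_table \<alpha> \<beta>))"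
    proof -
      have "Q (x - \<tau>) = Q (x - y) + (1 / s) *\<^sub>R Q (product_table \<alpha> \<beta>)"
        by (simp add: y linear_diff [OF lin_Q] linear_add [OF lin_Q] linear_scale [OF lin_Q])
      then show ?thesis
        using norm_triangle_ineq by metis
    qed
    then have 1: "m \<le> norm (Q (x - y)) + norm (Q (product_table \<alpha> \<beta>)) / s"
      using m(2) [OF \<tau>] s by (simp add: Q_def)
    show ?thesis
    proof (cases "norm (Q (x - y)) \<ge> m")
      case True
      have "onorm Q * K1 / s \<ge> 0"
        using s K1 onorm_Q by simp
      with True show ?thesis by (simp add: y_def)
    next
      case False
      have "1 \<bullet> y = 0"
        using tangent_space_sum_0 [OF \<tau>] \<alpha>\<beta> by (simp add: y inner_add_right inner_1_product_table)
      then have "Q y = R y"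
        by (simp add: Q_def centering_mult_vector)
      then have "\<mu> * norm y \<le> norm (Q y)"
        using \<mu>(2) by simp
      also have "norm (Q y) \<le> norm (Q x) + norm (Q (x - y))"
        using norm_triangle_ineq4 [of "Q x" "Q (x - y)"] by (simp add: linear_diff [OF lin_Q])
      finally have ny: "norm y \<le> K0"
        using False \<mu>(1) by (simp add: K0_def field_simps)
      have comp: "\<bar>y $ k\<bar> \<le> K0" for k
        using component_le_norm_cart [of y k] ny by linarith
      \<comment> \<open>Row sums recover \<alpha>, as \<open>b0\<close> sums to one and \<beta> to
        zero. The quadratic term has zero margins and does not interfere.\<close>
      have "\<alpha> $ i = (\<Sum>j\<in>UNIV. y $ (i, j))" for i
      proof -
        have "(\<Sum>j\<in>UNIV. y $ (i, j)) = \<alpha> $ i * (1 \<bullet> b0) + a0 $ i * (1 \<bullet> \<beta>) + \<alpha> $ i / s * (1 \<bullet> \<beta>)"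
          by (simp add: y \<tau>_def product_table_def inner_1_eq_sum sum.distrib sum_distrib_left)
        then show ?thesis by (simp add: \<alpha>\<beta> sums)
      qed
      then have "\<bar>\<alpha> $ i\<bar> \<le> real CARD('c) * K0" for i
        using sum_norm_bound [of UNIV "\<lambda>j. y $ (i, j)" K0] comp by simp
      then have \<alpha>: "\<bar>\<alpha> $ i\<bar> \<le> real CARD('r \<times> 'c) * K0" for i
        by (rule order_trans) (use K0 in \<open>auto intro!: mult_right_mono simp: card_prod simp flip: of_nat_mult\<close>)
      have "\<beta> $ j = (\<Sum>i\<in>UNIV. y $ (i, j))" for j
      proof -
        have "(\<Sum>i\<in>UNIV. y $ (i, j)) = (1 \<bullet> \<alpha>) * b0 $ j + (1 \<bullet> a0) * \<beta> $ j + (1 \<bullet> \<alpha>) * \<beta> $ j / s"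
          by (simp add: y \<tau>_def product_table_def inner_1_eq_sum sum.distrib sum_distrib_right sum_divide_distrib)
        then show ?thesis by (simp add: \<alpha>\<beta> sums)
      qed
      then have "\<bar>\<beta> $ j\<bar> \<le> real CARD('r) * K0" for j
        using sum_norm_bound [of UNIV "\<lambda>i. y $ (i, j)" K0] comp by simp
      then have \<beta>: "\<bar>\<beta> $ j\<bar> \<le> real CARD('r \<times> 'c) * K0" for j
        by (rule order_trans) (use K0 in \<open>auto intro!: mult_right_mono simp: card_prod simp flip: of_nat_mult\<close>)
      have "norm (product_table \<alpha> \<beta>) \<le> (\<Sum>k\<in>UNIV. \<bar>product_table \<alpha> \<beta> $ k\<bar>)"
        by (rule norm_le_l1_cart)
      also have "\<dots> \<le> (\<Sum>k\<in>(UNIV :: ('r \<times> 'c) set). (real CARD('r \<times> 'c) * K0)\<^sup>2)"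
        unfolding product_table_def power2_eq_square
        using K0 by (intro sum_mono) (simp add: abs_mult mult_mono \<alpha> \<beta> del: card_prod)
      also have "\<dots> = K1"
        by (simp add: K1_def)
      finally have "norm (Q (product_table \<alpha> \<beta>)) \<le> onorm Q * K1"
        using onorm [OF bounded_Q] onorm_Q by (meson mult_left_mono order_trans)
      then have "norm (Q (product_table \<alpha> \<beta>)) / s \<le> onorm Q * K1 / s"
        using s by (simp add: divide_right_mono)
      with 1 show ?thesis
        by (simp add: y_def)
    qed
  qed
  then show ?thesis
    by (intro that [of "onorm Q * K1"]) (simp add: Q_def)
qed

text \<open>A sandwich for fixed \<open>x\<close>. A move of order 1 / sqrt n along an optimal
  tangent direction bounds the infimum above; below, the deviation bound holds for all parameters at
  once, with a factor for the error in the estimated covariance.\<close>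

lemma min_private_statistic_tendsto:
  fixes a0 :: "real^'r::finite" and b0 :: "real^'c::finite" and x :: "real^('r \<times> 'c)"
    and R :: "real^('r \<times> 'c) \<Rightarrow> real^('r \<times> 'c)" and \<rho> :: real
  defines "p \<equiv> product_table a0 b0"
  defines "\<Sigma> \<equiv> diag_matrix p - outer_product p p + (1 / \<rho>) *\<^sub>R mat 1"
  assumes \<rho>: "\<rho> > 0" and a0: "a0 \<in> positive_prob_vectors" and b0: "b0 \<in> positive_prob_vectors"
    and R: "linear R" "inj R" "\<And>v. v \<bullet> (matrix_inv \<Sigma> *v v) = (norm (R v))\<^sup>2"
    and lower: "\<And>\<tau>. \<tau> \<in> tangent_space a0 b0 \<Longrightarrow> T \<le> (norm (R (centering_matrix *v (x - \<tau>))))\<^sup>2"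
    and attained: "\<exists>\<tau>\<in>tangent_space a0 b0. (norm (R (centering_matrix *v (x - \<tau>))))\<^sup>2 = T"
  shows "(\<lambda>n. min_private_statistic d \<rho> n (real n *\<^sub>R p) (sqrt n *\<^sub>R x)) \<longlonglongrightarrow> T"
proof -
  define M where "M n = covariance_estimate \<rho> n (real n *\<^sub>R p) (sqrt n *\<^sub>R x)" for n
  define E where "E n = matrix_inv (M n)" for n
  define e where "e n = 1 / sqrt (real n)" for n
  have e: "e \<longlonglongrightarrow> 0"
    unfolding e_def
    by (intro real_tendsto_divide_at_top [where c = 1] tendsto_const filterlim_compose [OF sqrt_at_top filterlim_real_sequentially])
  have inv: "invertible \<Sigma>"
    unfolding \<Sigma>_def using a0 b0 \<rho> by (intro invertible_covariance) (simp_all add: p_def product_table_positive)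
  have M: "M \<longlonglongrightarrow> \<Sigma>"
    unfolding M_def \<Sigma>_def p_def using a0 b0 by (rule covariance_estimate_tendsto)
  have E: "E \<longlonglongrightarrow> matrix_inv \<Sigma>"
    unfolding E_def using M inv by (rule tendsto_matrix_inv)
  define G where "G n = (INF (a, b) \<in> positive_prob_vectors \<times> positive_prob_vectors.
              private_statistic \<rho> n (real n *\<^sub>R p) (sqrt n *\<^sub>R x) a b)" for n
  have "eventually (\<lambda>n. invertible (M n)) sequentially"
    using M inv by (rule tendsto_matrix_inv)
  moreover have "eventually (\<lambda>n. noisy_size n (sqrt n *\<^sub>R x) \<noteq> 0) sequentially"
    using a0 b0 by (rule covariance_estimate_tendsto)
  ultimately have G: "eventually (\<lambda>n. G n = min_private_statistic d \<rho> n (real n *\<^sub>R p) (sqrt n *\<^sub>R x)) sequentially"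
    by eventually_elim (simp add: min_private_statistic_def G_def M_def)
  define Y where "Y n a b = centering_matrix *v (x - sqrt n *\<^sub>R (product_table a b - p))" for n :: nat and a b
  have stat: "private_statistic \<rho> n (real n *\<^sub>R p) (sqrt n *\<^sub>R x) a b = Y n a b \<bullet> (E n *v Y n a b)" if "n > 0" for n a b
    using private_statistic_rescaled [OF that] by (simp add: Y_def E_def M_def Let_def)
  obtain \<tau> where \<tau>: "\<tau> \<in> tangent_space a0 b0" "(norm (R (centering_matrix *v (x - \<tau>))))\<^sup>2 = T"
    using attained by blast
  then obtain g h where gh: "\<tau> = product_table g b0 + product_table a0 h" "1 \<bullet> g = 0" "1 \<bullet> h = 0"
    by (auto simp: tangent_space_def)
  \<comment> \<open>The step \<open>e n\<close> cancels the factor sqrt n, leaving \<tau> plus a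
    bilinear error of size \<open>e n\<close>.\<close>
  define u where "u n = Y n (a0 + e n *\<^sub>R g) (b0 + e n *\<^sub>R h)" for n
  have "eventually (\<lambda>n. G n \<le> u n \<bullet> (E n *v u n)) sequentially"
    using positive_prob_vectors_perturb [OF a0 gh(2) e] positive_prob_vectors_perturb [OF b0 gh(3) e] eventually_gt_at_top [of 0]
  proof eventually_elim
    case (elim n)
    then have "G n \<le> (\<lambda>(a, b). private_statistic \<rho> n (real n *\<^sub>R p) (sqrt n *\<^sub>R x) a b) (a0 + e n *\<^sub>R g, b0 + e n *\<^sub>R h)"
      unfolding G_def by (intro cINF_lower bdd_below_private_statistic) auto
    with elim show ?case
      by (simp add: stat u_def)
  qed
  moreover have "(\<lambda>n. u n \<bullet> (E n *v u n)) \<longlonglongrightarrow> T"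
  proof -
    have "(\<lambda>n. centering_matrix *v (x - (\<tau> + e n *\<^sub>R product_table g h))) \<longlonglongrightarrow> centering_matrix *v (x - (\<tau> + 0 *\<^sub>R product_table g h))"
      by (intro tendsto_matrix_vector_mult tendsto_intros e)
    moreover have "eventually (\<lambda>n. centering_matrix *v (x - (\<tau> + e n *\<^sub>R product_table g h)) = u n) sequentially"
    proof (rule eventually_sequentiallyI [of 1])
      fix n :: nat assume "n \<ge> 1"
      then have 1: "sqrt n * e n = 1"
        by (simp add: e_def)
      then have "sqrt n * (e n * e n) = e n"
        by (simp add: mult.assoc [symmetric])
      with 1 have "sqrt n *\<^sub>R (product_table (a0 + e n *\<^sub>R g) (b0 + e n *\<^sub>R h) - p) = \<tau> + e n *\<^sub>R product_table g h"
        by (simp add: p_def gh(1) product_table_diff product_table_scaleR scaleR_add_right)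
      then show "centering_matrix *v (x - (\<tau> + e n *\<^sub>R product_table g h)) = u n"
        by (simp add: u_def Y_def)
    qed
    ultimately have "u \<longlonglongrightarrow> centering_matrix *v (x - \<tau>)"
      using Lim_transform_eventually by fastforce
    then have "(\<lambda>n. u n \<bullet> (E n *v u n)) \<longlonglongrightarrow> (centering_matrix *v (x - \<tau>)) \<bullet> (matrix_inv \<Sigma> *v (centering_matrix *v (x - \<tau>)))"
      by (intro tendsto_inner tendsto_matrix_vector_mult E)
    then show ?thesis
      by (simp add: R(3) \<tau>(2))
  qed
  moreover obtain K where K: "\<And>a b s. a \<in> positive_prob_vectors \<Longrightarrow> b \<in> positive_prob_vectors \<Longrightarrow> s > 0 \<Longrightarrow>
     sqrt T - K / s \<le> norm (R (centering_matrix *v (x - s *\<^sub>R (product_table a b - product_table a0 b0))))"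
  proof (rule product_table_deviation_lower_bound [OF a0 b0 R(1,2), of "sqrt T" x])
    show "sqrt T \<ge> 0"
      using \<tau>(2) by auto
    show "sqrt T \<le> norm (R (centering_matrix *v (x - \<tau>)))" if "\<tau> \<in> tangent_space a0 b0" for \<tau>
      using lower [OF that] by (simp add: real_le_lsqrt)
  qed blast
  obtain \<mu> where \<mu>: "\<mu> > 0" "\<And>y. \<mu> * norm y \<le> norm (R y)"
    using linear_inj_bounded_below_pos [OF R(1,2)] by blast
  \<comment> \<open>Dividing by the square of \<mu> expresses the error of the quadratic form
    relative to \<open>(norm (R v))\<^sup>2\<close>.\<close>
  define \<epsilon> where "\<epsilon> n = (\<Sum>i\<in>UNIV. \<Sum>j\<in>UNIV. \<bar>(E n - matrix_inv \<Sigma>) $ i $ j\<bar>) / \<mu>\<^sup>2" for n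
  \<comment> \<open>The lower bound on \<open>norm (R v)\<close> may be negative for small n;
    cutting it at zero keeps squaring monotone.\<close>
  define l where "l n = (1 - \<epsilon> n) * (max 0 (sqrt T - K * e n))\<^sup>2" for n
  have "(\<lambda>n. \<epsilon> n) \<longlonglongrightarrow> (\<Sum>i\<in>UNIV. \<Sum>j\<in>UNIV. \<bar>(matrix_inv \<Sigma> - matrix_inv \<Sigma>) $ i $ j\<bar>) / \<mu>\<^sup>2"
    unfolding \<epsilon>_def using \<mu>(1) by (intro tendsto_intros E) auto
  then have \<epsilon>: "\<epsilon> \<longlonglongrightarrow> 0"
    by simp
  have l_le: "eventually (\<lambda>n. l n \<le> G n) sequentially"
    using order_tendstoD(2) [OF \<epsilon>, of 1, OF zero_less_one] eventually_gt_at_top [of 0]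
  proof eventually_elim
    case (elim n)
    have "l n \<le> Y n a b \<bullet> (E n *v Y n a b)" if "a \<in> positive_prob_vectors" "b \<in> positive_prob_vectors" for a b
    proof -
      define v where "v = Y n a b"
      have "\<bar>v \<bullet> ((E n - matrix_inv \<Sigma>) *v v)\<bar> \<le> \<epsilon> n * \<mu>\<^sup>2 * (norm v)\<^sup>2"
        using abs_quadratic_form_le [of v "E n - matrix_inv \<Sigma>"] \<mu>(1) by (simp add: \<epsilon>_def)
      also have "\<dots> = \<epsilon> n * (\<mu> * norm v)\<^sup>2"
        by (simp add: power_mult_distrib)
      also have "\<dots> \<le> \<epsilon> n * (norm (R v))\<^sup>2"
        using \<mu> by (intro mult_left_mono power_mono) (auto simp: \<epsilon>_def intro!: divide_nonneg_nonneg sum_nonneg)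
      finally have "(1 - \<epsilon> n) * (norm (R v))\<^sup>2 \<le> v \<bullet> (E n *v v)"
        by (simp add: matrix_vector_mult_diff_rdistrib inner_diff_right R(3) algebra_simps)
      moreover have "sqrt T - K * e n \<le> norm (R v)"
        using K [OF that, of "sqrt n"] elim by (simp add: v_def Y_def p_def e_def)
      then have "l n \<le> (1 - \<epsilon> n) * (norm (R v))\<^sup>2"
        unfolding l_def using elim by (intro mult_left_mono power_mono) auto
      ultimately show ?thesis
        by (simp add: v_def)
    qed
    then have "l n \<le> private_statistic \<rho> n (real n *\<^sub>R p) (sqrt n *\<^sub>R x) a b"
      if "a \<in> positive_prob_vectors" "b \<in> positive_prob_vectors" for a b
      using that elim by (simp add: stat)
    then show ?case
      unfolding G_def using a0 b0 by (intro cINF_greatest) auto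
  qed
  have l_lim: "l \<longlonglongrightarrow> T"
  proof -
    have "l \<longlonglongrightarrow> (1 - 0) * (max 0 (sqrt T - K * 0))\<^sup>2"
      unfolding l_def by (intro tendsto_intros \<epsilon> e)
    moreover have "T \<ge> 0"
      using \<tau>(2) by auto
    ultimately show ?thesis by simp
  qed
  ultimately have "G \<longlonglongrightarrow> T"
    by (intro tendsto_sandwich [OF l_le _ l_lim])
  then show ?thesis
    using G by (rule Lim_transform_eventually)
qed

section \<open>Measurability of the minimal statistic\<close>

lemma continuous_on_covariance_estimate:
  fixes f g :: "'a::topological_space \<Rightarrow> real^('r::finite \<times> 'c::finite)"
  assumes f: "continuous_on S f" and g: "continuous_on S g" and nz: "\<And>w. w \<in> S \<Longrightarrow> noisy_size n (g w) \<noteq> 0"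
  shows "continuous_on S (\<lambda>w. covariance_estimate \<rho> n (f w) (g w))"
proof -
  have size: "continuous_on S (\<lambda>w. noisy_size n (g w))"
    unfolding noisy_size_def by (intro continuous_intros g)
  have row: "continuous_on S (\<lambda>w. row_estimate n (f w) (g w))"
    unfolding row_estimate_def by (intro continuous_intros continuous_on_vec_lambda f g size) (use nz in auto)
  have column: "continuous_on S (\<lambda>w. column_estimate n (f w) (g w))"
    unfolding column_estimate_def by (intro continuous_intros continuous_on_vec_lambda f g size) (use nz in auto)
  have p: "continuous_on S (\<lambda>w. product_table (row_estimate n (f w) (g w)) (column_estimate n (f w) (g w)))"
    by (intro continuous_intros row column)
  have diag: "continuous_on S (\<lambda>w. diag_matrix (P w))" "continuous_on S (\<lambda>w. outer_product (P w) (P w))"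
    if P: "continuous_on S P" for P :: "'a \<Rightarrow> real^('r \<times> 'c)"
  proof -
    have "continuous_on S (\<lambda>w. if i = j then P w $ i else 0)" for i j
      using P by (cases "i = j") (auto intro!: continuous_intros)
    then show "continuous_on S (\<lambda>w. diag_matrix (P w))"
      unfolding diag_matrix_def by (intro continuous_on_vec_lambda)
    show "continuous_on S (\<lambda>w. outer_product (P w) (P w))"
      unfolding outer_product_def by (intro continuous_on_vec_lambda continuous_intros P)
  qed
  show ?thesis
    unfolding covariance_estimate_def Let_def by (intro continuous_intros diag p)
qed

text \<open>On the open set where the statistic is genuine it is an infimum of continuous functions, hence
  upper semicontinuous.\<close>

lemma measurable_min_private_statistic:
  "(\<lambda>(h, z). min_private_statistic d \<rho> n h z) \<in>
     borel_measurable (borel :: ((real^('r::finite \<times> 'c::finite)) \<times> (real^('r \<times> 'c))) measure)"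
proof -
  let ?P = "positive_prob_vectors \<times> positive_prob_vectors :: ((real^'r) \<times> (real^'c)) set"
  define S where "S = {w :: (real^('r \<times> 'c)) \<times> (real^('r \<times> 'c)). noisy_size n (snd w) \<noteq> 0}"
  define C where "C w = covariance_estimate \<rho> n (fst w) (snd w)" for w :: "(real^('r \<times> 'c)) \<times> (real^('r \<times> 'c))"
  define G where "G = S \<inter> (\<lambda>w. det (C w)) -` (- {0})"
  define q where "q w ab = private_statistic \<rho> n (fst w) (snd w) (fst ab) (snd ab)"
    for w :: "(real^('r \<times> 'c)) \<times> (real^('r \<times> 'c))" and ab
  have "continuous_on UNIV (\<lambda>w :: (real^('r \<times> 'c)) \<times> (real^('r \<times> 'c)). noisy_size n (snd w))"
    unfolding noisy_size_def by (intro continuous_intros)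
  then have "open S"
    unfolding S_def by (intro open_Collect_neq continuous_on_const) auto
  have C: "continuous_on S C"
    unfolding C_def by (intro continuous_on_covariance_estimate continuous_intros) (simp add: S_def)
  then have "continuous_on S (\<lambda>w. det (C w))"
    by (auto simp: continuous_on_def intro: tendsto_det)
  then have "open G"
    unfolding G_def using \<open>open S\<close> by (intro continuous_open_preimage) auto
  have inv: "invertible (C w)" if "w \<in> G" for w
    using that by (simp add: G_def invertible_det_nz)
  have "continuous_on G C"
    using C by (rule continuous_on_subset) (auto simp: G_def)
  then have inv_cont: "continuous_on G (\<lambda>w. matrix_inv (C w))"
    using inv by (auto simp: continuous_on_def intro: tendsto_matrix_inv)
  have q_cont: "continuous_on G (\<lambda>w. q w ab)" for ab
  proof -
    define y where "y w = centering_matrix *v (fst w + snd w - real n *\<^sub>R product_table (fst ab) (snd ab))"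
      for w :: "(real^('r \<times> 'c)) \<times> (real^('r \<times> 'c))"
    have "continuous_on G y"
      unfolding y_def continuous_on_def by (auto intro!: tendsto_matrix_vector_mult tendsto_intros)
    then have "continuous_on G (\<lambda>w. y w \<bullet> (matrix_inv (C w) *v y w))"
      using inv_cont by (auto simp: continuous_on_def intro!: tendsto_matrix_vector_mult tendsto_intros)
    then have "continuous_on G (\<lambda>w. 1 / real n * (y w \<bullet> (matrix_inv (C w) *v y w)))"
      by (intro continuous_on_mult continuous_on_const)
    then show ?thesis
      by (simp add: q_def private_statistic_def Let_def centering_quadratic_form y_def C_def)
  qed
  have bdd: "bdd_below (q w ` ?P)" for w
    using bdd_below_private_statistic [of \<rho> n "fst w" "snd w"] by (simp add: q_def split_beta')
  have nonempty: "?P \<noteq> {}"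
  proof -
    have "(\<chi> i. 1 / real CARD('r)) \<in> (positive_prob_vectors :: (real^'r) set)"
      "(\<chi> i. 1 / real CARD('c)) \<in> (positive_prob_vectors :: (real^'c) set)"
      by (simp_all add: positive_prob_vectors_def)
    then show ?thesis by blast
  qed
  have eq: "(\<lambda>(h, z). min_private_statistic d \<rho> n h z) = (\<lambda>w. if w \<in> G then INF ab\<in>?P. q w ab else d)"
    by (auto simp: fun_eq_iff min_private_statistic_def G_def S_def C_def q_def invertible_det_nz split_beta')
  have "{w. (if w \<in> G then INF ab\<in>?P. q w ab else d) < c} \<in> sets borel" for c
  proof -
    \<comment> \<open>The union is uncountable, hence the recourse to openness of its members rather
      than their measurability.\<close>
    have "{w. (if w \<in> G then INF ab\<in>?P. q w ab else d) < c} =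
        (\<Union>ab\<in>?P. G \<inter> (\<lambda>w. q w ab) -` {..<c}) \<union> (if d < c then - G else {})"
      using cINF_less_iff [OF nonempty bdd] by auto
    moreover have "open (\<Union>ab\<in>?P. G \<inter> (\<lambda>w. q w ab) -` {..<c})"
      using q_cont \<open>open G\<close> by (intro open_UN ballI continuous_open_preimage) auto
    ultimately show ?thesis
      using \<open>open G\<close> by auto
  qed
  then show ?thesis
    unfolding eq by (subst borel_measurable_iff_less) simp
qed

section \<open>The limit law\<close>

lemma char_gaussian_smoothing:
  fixes \<nu> :: "'e::euclidean_space measure"
  assumes \<nu>: "prob_space \<nu>" and sets_\<nu>[measurable_cong]: "sets \<nu> = sets borel"
  shows "(\<integral>x. cis (t \<bullet> x) \<partial>gaussian_smoothing s \<nu>) = (\<integral>w. cis (t \<bullet> w) \<partial>\<nu>) * of_real (exp (- (s * norm t)\<^sup>2 / 2))"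
proof -
  interpret prob_space \<nu> by fact
  interpret pair_prob_space \<nu> "std_gaussian :: 'e measure" by unfold_locales
  have "(\<integral>x. cis (t \<bullet> x) \<partial>gaussian_smoothing s \<nu>) = (\<integral>(w, g). cis (t \<bullet> (w + s *\<^sub>R g)) \<partial>(\<nu> \<Otimes>\<^sub>M std_gaussian))"
    unfolding gaussian_smoothing_def by (subst integral_distr) (auto simp: cis_conv_exp split_beta')
  also have "\<dots> = (\<integral>w. \<integral>g. cis (t \<bullet> (w + s *\<^sub>R g)) \<partial>std_gaussian \<partial>\<nu>)"
    by (rule integral_fst' [symmetric, of "\<lambda>(w, g). cis (t \<bullet> (w + s *\<^sub>R g))", simplified])
       (use integrable_cis [OF P.prob_space_axioms, of "\<lambda>(w, g). t \<bullet> (w + s *\<^sub>R g)"] in \<open>simp add: split_beta'\<close>)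
  also have "\<dots> = (\<integral>w. \<integral>g. cis (t \<bullet> w) * cis ((s *\<^sub>R t) \<bullet> g) \<partial>std_gaussian \<partial>\<nu>)"
    by (simp add: inner_add_right cis_mult)
  also have "\<dots> = (\<integral>w. cis (t \<bullet> w) * of_real (exp (- (norm (s *\<^sub>R t))\<^sup>2 / 2)) \<partial>\<nu>)"
    by (simp only: integral_mult_right_zero char_std_gaussian)
  finally show ?thesis
    by (simp add: power_mult_distrib)
qed

text \<open>Matches the density of the noise table with the smoothing kernel centred at
  zero.\<close>

lemma multivariate_normal_density_scaled_identity:
  fixes x :: "real^'n"
  assumes s: "s > 0"
  shows "multivariate_normal_density 0 (s\<^sup>2 *\<^sub>R mat 1) x =
    exp (- (norm (x /\<^sub>R s))\<^sup>2 / 2) / (sqrt (2 * pi) * s) ^ CARD('n)"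
proof -
  have prod: "(s\<^sup>2 *\<^sub>R mat 1) ** ((1 / s\<^sup>2) *\<^sub>R mat 1) = (mat 1 :: real^'n^'n)"
    using s by (simp add: matrix_scalar_ac scalar_matrix_assoc [symmetric])
  then have inv: "invertible (s\<^sup>2 *\<^sub>R mat 1 :: real^'n^'n)"
    using invertible_right_inverse by blast
  have "matrix_inv (s\<^sup>2 *\<^sub>R mat 1) *v x = (1 / s\<^sup>2) *\<^sub>R x"
  proof -
    have "(s\<^sup>2 *\<^sub>R mat 1) *v (matrix_inv (s\<^sup>2 *\<^sub>R mat 1) *v x) = x"
      by (simp only: matrix_vector_mul_assoc matrix_inv_mult [OF inv] matrix_vector_mul_lid)
    then have "s\<^sup>2 *\<^sub>R (matrix_inv (s\<^sup>2 *\<^sub>R mat 1) *v x) = x"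
      by (simp add: scaleR_matrix_vector_assoc [symmetric])
    then have "(1 / s\<^sup>2) *\<^sub>R (s\<^sup>2 *\<^sub>R (matrix_inv (s\<^sup>2 *\<^sub>R mat 1) *v x)) = (1 / s\<^sup>2) *\<^sub>R x"
      by simp
    then show ?thesis using s by simp
  qed
  moreover have "det (s\<^sup>2 *\<^sub>R mat 1 :: real^'n^'n) = (s\<^sup>2) ^ CARD('n)"
    by (subst det_diagonal) (auto simp: mat_def)
  moreover have "sqrt ((2 * pi) ^ CARD('n) * (s\<^sup>2) ^ CARD('n)) = (sqrt (2 * pi) * s) ^ CARD('n)"
    using s by (simp add: real_sqrt_mult real_sqrt_power power_mult_distrib)
  moreover have "x \<bullet> ((1 / s\<^sup>2) *\<^sub>R x) = (norm (x /\<^sub>R s))\<^sup>2"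
    using s unfolding power2_norm_eq_inner by (simp add: power2_eq_square divide_inverse)
  ultimately show ?thesis
    by (simp only: multivariate_normal_density_def diff_zero)
qed

lemma distr_multivariate_normal_rescaled:
  fixes Z :: "'a \<Rightarrow> real^'n"
  assumes s: "s > 0"
    and Z: "distributed M lborel Z (\<lambda>x. ennreal (multivariate_normal_density 0 (s\<^sup>2 *\<^sub>R mat 1) x))"
  shows "distr M borel (\<lambda>\<omega>. (1 / s) *\<^sub>R Z \<omega>) = std_gaussian"
proof -
  have [measurable]: "Z \<in> borel_measurable M"
    using Z by (simp add: distributed_def)
  have law: "distr M borel Z = distr std_gaussian borel (\<lambda>g. s *\<^sub>R g)"
  proof (rule measure_eqI)
    fix A assume "A \<in> sets (distr M borel Z)"
    then have A[measurable]: "A \<in> sets borel" by simp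
    have "emeasure (distr M borel Z) A = emeasure M (Z -` A \<inter> space M)"
      by (simp add: emeasure_distr)
    also have "\<dots> = (\<integral>\<^sup>+x. ennreal (multivariate_normal_density 0 (s\<^sup>2 *\<^sub>R mat 1) x) * indicator A x \<partial>lborel)"
      using Z by (rule distributed_emeasure) simp
    also have "\<dots> = emeasure std_gaussian {g. 0 + s *\<^sub>R g \<in> A}"
      using s by (subst emeasure_std_gaussian_affine) (simp_all add: multivariate_normal_density_scaled_identity)
    also have "\<dots> = emeasure (distr std_gaussian borel (\<lambda>g. s *\<^sub>R g)) A"
      by (subst emeasure_distr) (auto intro!: arg_cong2 [where f = emeasure])
    finally show "emeasure (distr M borel Z) A = emeasure (distr std_gaussian borel (\<lambda>g. s *\<^sub>R g)) A" .
  qed simp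
  have "distr M borel (\<lambda>\<omega>. (1 / s) *\<^sub>R Z \<omega>) = distr (distr M borel Z) borel (\<lambda>x. (1 / s) *\<^sub>R x)"
    by (simp add: distr_distr o_def)
  also have "\<dots> = distr std_gaussian borel (\<lambda>g. g)"
    unfolding law using s by (simp add: distr_distr o_def)
  also have "\<dots> = std_gaussian"
    by (rule distr_id2) simp
  finally show ?thesis .
qed

text \<open>The pair is swapped: the noise comes second, as in the product underlying
  \<open>gaussian_smoothing\<close>.\<close>

lemma (in prob_space) distr_pair_independent_rvs:
  assumes indep: "independent_rvs M S X T Y" and f: "f \<in> measurable S S'" and g: "g \<in> measurable T T'"
  shows "distr M (T' \<Otimes>\<^sub>M S') (\<lambda>\<omega>. (g (Y \<omega>), f (X \<omega>))) = distr M T' (\<lambda>\<omega>. g (Y \<omega>)) \<Otimes>\<^sub>M distr M S' (\<lambda>\<omega>. f (X \<omega>))"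
proof (rule pair_measure_eqI [symmetric])
  have [measurable]: "X \<in> measurable M S" "Y \<in> measurable M T"
    using indep by (simp_all add: independent_rvs_def)
  note [measurable] = f g
  interpret Y: prob_space "distr M T' (\<lambda>\<omega>. g (Y \<omega>))" by (rule prob_space_distr) measurable
  interpret X: prob_space "distr M S' (\<lambda>\<omega>. f (X \<omega>))" by (rule prob_space_distr) measurable
  show "sigma_finite_measure (distr M T' (\<lambda>\<omega>. g (Y \<omega>)))" "sigma_finite_measure (distr M S' (\<lambda>\<omega>. f (X \<omega>)))"
    by unfold_locales
  show "sets (distr M T' (\<lambda>\<omega>. g (Y \<omega>)) \<Otimes>\<^sub>M distr M S' (\<lambda>\<omega>. f (X \<omega>))) = sets (distr M (T' \<Otimes>\<^sub>M S') (\<lambda>\<omega>. (g (Y \<omega>), f (X \<omega>))))"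
    by (simp cong: sets_pair_measure_cong)
  fix A B assume "A \<in> sets (distr M T' (\<lambda>\<omega>. g (Y \<omega>)))" "B \<in> sets (distr M S' (\<lambda>\<omega>. f (X \<omega>)))"
  then have [measurable]: "A \<in> sets T'" "B \<in> sets S'" by simp_all
  have spaces: "X \<omega> \<in> space S" "Y \<omega> \<in> space T" if "\<omega> \<in> space M" for \<omega>
    using that by (auto intro: measurable_space)
  have "prob {\<omega> \<in> space M. X \<omega> \<in> f -` B \<inter> space S \<and> Y \<omega> \<in> g -` A \<inter> space T} =
      prob {\<omega> \<in> space M. X \<omega> \<in> f -` B \<inter> space S} * prob {\<omega> \<in> space M. Y \<omega> \<in> g -` A \<inter> space T}"
    by (rule independent_rvs_prob [OF indep]) measurable
  moreover have "{\<omega> \<in> space M. X \<omega> \<in> f -` B \<inter> space S \<and> Y \<omega> \<in> g -` A \<inter> space T} =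
      (\<lambda>\<omega>. (g (Y \<omega>), f (X \<omega>))) -` (A \<times> B) \<inter> space M"
    "{\<omega> \<in> space M. X \<omega> \<in> f -` B \<inter> space S} = (\<lambda>\<omega>. f (X \<omega>)) -` B \<inter> space M"
    "{\<omega> \<in> space M. Y \<omega> \<in> g -` A \<inter> space T} = (\<lambda>\<omega>. g (Y \<omega>)) -` A \<inter> space M"
    using spaces by auto
  ultimately show "emeasure (distr M T' (\<lambda>\<omega>. g (Y \<omega>))) A * emeasure (distr M S' (\<lambda>\<omega>. f (X \<omega>))) B =
      emeasure (distr M (T' \<Otimes>\<^sub>M S') (\<lambda>\<omega>. (g (Y \<omega>), f (X \<omega>)))) (A \<times> B)"
    by (simp add: emeasure_distr emeasure_eq_measure mult.commute flip: ennreal_mult)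
qed

text \<open>Continuity at \<open>c\<close> means that \<open>g\<close> takes the value
  \<open>c\<close> with probability zero; elsewhere the indicators converge. The restriction matters
  for one row or one column, where the limit is a point mass at 0.\<close>

lemma cdf_tendsto_of_pointwise:
  fixes f :: "nat \<Rightarrow> 'b \<Rightarrow> real"
  assumes "prob_space N" and [measurable]: "\<And>n. f n \<in> borel_measurable N" "g \<in> borel_measurable N"
    and lim: "\<And>x. (\<lambda>n. f n x) \<longlonglongrightarrow> g x"
    and cont: "isCont (cdf (distr N borel g)) c"
  shows "(\<lambda>n. measure N {x \<in> space N. f n x \<le> c}) \<longlonglongrightarrow> cdf (distr N borel g) c"
proof -
  interpret prob_space N by fact
  interpret g: real_distribution "distr N borel g"
    by (rule real_distribution_distr) simp
  have "prob {x \<in> space N. g x = c} = 0"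
    using cont unfolding g.isCont_cdf by (simp add: measure_distr vimage_def Int_def conj_commute)
  then have ae: "AE x in N. g x \<noteq> c"
    by (subst (asm) prob_eq_0) auto
  have "(\<lambda>n. \<integral>x. indicat_real {x \<in> space N. f n x \<le> c} x \<partial>N) \<longlonglongrightarrow> (\<integral>x. indicat_real {x \<in> space N. g x \<le> c} x \<partial>N)"
  proof (rule integral_dominated_convergence [where w = "\<lambda>_. 1"])
    show "AE x in N. (\<lambda>n. indicator {x \<in> space N. f n x \<le> c} x :: real) \<longlonglongrightarrow> indicator {x \<in> space N. g x \<le> c} x"
      using ae AE_space
    proof eventually_elim
      case (elim x)
      show ?case
      proof (cases "g x < c")
        case True
        have "eventually (\<lambda>n. f n x < c) sequentially"
          using lim True by (rule order_tendstoD(2))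
        then have "eventually (\<lambda>n. indicator {x \<in> space N. f n x \<le> c} x = (1 :: real)) sequentially"
          by eventually_elim (use elim in simp)
        with True elim show ?thesis by (simp add: tendsto_eventually)
      next
        case False
        then have "g x > c" using elim by simp
        then have "eventually (\<lambda>n. f n x > c) sequentially"
          by (rule order_tendstoD(1) [OF lim])
        then have "eventually (\<lambda>n. indicator {x \<in> space N. f n x \<le> c} x = (0 :: real)) sequentially"
          by eventually_elim simp
        with \<open>g x > c\<close> show ?thesis by (simp add: tendsto_eventually)
      qed
    qed
  qed (auto simp: indicator_def)
  moreover have "cdf (distr N borel g) c = prob {x \<in> space N. g x \<le> c}"
    unfolding cdf_def by (subst measure_distr) (auto intro!: arg_cong2 [where f = measure])
  ultimately show ?thesis
    by simp
qed

theorem theorem6p3: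
  fixes M :: "nat \<Rightarrow> 'a measure"
    and U :: "nat \<Rightarrow> nat \<Rightarrow> 'a \<Rightarrow> real^'r::finite"
    and V :: "nat \<Rightarrow> nat \<Rightarrow> 'a \<Rightarrow> real^'c::finite"
    and Z :: "nat \<Rightarrow> 'a \<Rightarrow> real^('r \<times> 'c)"
    and \<pi>1 :: "real^'r" and \<pi>2 :: "real^'c"
    and \<rho> d :: real
  assumes rho: "\<rho> > 0"
    and pi1: "\<pi>1 \<in> positive_prob_vectors"
    and pi2: "\<pi>2 \<in> positive_prob_vectors"
    and prob: "\<And>n. n \<ge> 1 \<Longrightarrow> prob_space (M n)"
    and U_law: "\<And>n l. n \<ge> 1 \<Longrightarrow> l \<in> {1..n} \<Longrightarrow> multinomial1_distributed (M n) (U n l) \<pi>1"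
    and V_law: "\<And>n l. n \<ge> 1 \<Longrightarrow> l \<in> {1..n} \<Longrightarrow> multinomial1_distributed (M n) (V n l) \<pi>2"
    and pairs_indep: "\<And>n. n \<ge> 1 \<Longrightarrow>
      prob_space.indep_vars (M n) (\<lambda>_. borel) (\<lambda>l \<omega>. (U n l \<omega>, V n l \<omega>)) {1..n}"
    and pairs_ident: "\<And>n l l'. n \<ge> 1 \<Longrightarrow> l \<in> {1..n} \<Longrightarrow> l' \<in> {1..n} \<Longrightarrow>
      distr (M n) borel (\<lambda>\<omega>. (U n l \<omega>, V n l \<omega>)) = distr (M n) borel (\<lambda>\<omega>. (U n l' \<omega>, V n l' \<omega>))"
    and Z_law: "\<And>n. n \<ge> 1 \<Longrightarrow>
      distributed (M n) lborel (Z n)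
        (\<lambda>x. ennreal (multivariate_normal_density 0 ((real n / \<rho>) *\<^sub>R mat 1) x))"
    and Z_indep: "\<And>n. n \<ge> 1 \<Longrightarrow>
      independent_rvs (M n) borel (Z n)
        (\<Pi>\<^sub>M l\<in>{1..n}. borel) (\<lambda>\<omega>. \<lambda>l\<in>{1..n}. (U n l \<omega>, V n l \<omega>))"
    and UV_indep: "\<And>n l. n \<ge> 1 \<Longrightarrow> l \<in> {1..n} \<Longrightarrow>
      independent_rvs (M n) borel (U n l) borel (V n l)"
  shows "weak_conv_m
    (\<lambda>n. distr (M n) borel
      (\<lambda>\<omega>. min_private_statistic d \<rho> n
              (contingency_table n (\<lambda>l. U n l \<omega>) (\<lambda>l. V n l \<omega>)) (Z n \<omega>)))
    (chi_square_distribution ((CARD('r) - 1) * (CARD('c) - 1)))"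
proof -
  define p where "p = product_table \<pi>1 \<pi>2"
  define \<sigma> where "\<sigma> = 1 / sqrt \<rho>"
  have \<sigma>: "\<sigma> > 0" "\<sigma>\<^sup>2 = 1 / \<rho>"
    using rho by (simp_all add: \<sigma>_def power_divide)
  have p: "p \<in> positive_prob_vectors"
    unfolding p_def using pi1 pi2 by (rule product_table_positive)
  have sum_p: "(\<Sum>k\<in>UNIV. p $ k) = 1" and p_nonneg: "p $ k \<ge> 0" for k
    using p less_imp_le unfolding positive_prob_vectors_def by blast+
  from rho have rho': "1 / \<rho> > 0" by simp
  obtain A R :: "real^('r \<times> 'c) \<Rightarrow> real^('r \<times> 'c)" and B :: "(real^('r \<times> 'c)) set" where
    A1: "linear A" and R: "linear R" "inj R"
    and A2: "\<And>s t. A s \<bullet> A t = (\<Sum>k\<in>UNIV. (p $ k + 1 / \<rho>) * s $ k * t $ k) - (p \<bullet> s) * (p \<bullet> t)"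
    and AR: "\<And>t. norm (A (adjoint R t)) = norm t"
    and inv: "\<And>v. v \<bullet> (matrix_inv (diag_matrix p - outer_product p p + (1 / \<rho>) *\<^sub>R mat 1) *v v) = (norm (R v))\<^sup>2"
    and B: "finite B" "pairwise orthogonal B" "\<And>f. f \<in> B \<Longrightarrow> norm f = 1" "card B = (CARD('r) - 1) * (CARD('c) - 1)"
    and lower: "\<And>x \<tau>. \<tau> \<in> tangent_space \<pi>1 \<pi>2 \<Longrightarrow> (\<Sum>f\<in>B. (f \<bullet> R x)\<^sup>2) \<le> (norm (R (centering_matrix *v (x - \<tau>))))\<^sup>2"
    and attained: "\<And>x. \<exists>\<tau>\<in>tangent_space \<pi>1 \<pi>2. (norm (R (centering_matrix *v (x - \<tau>))))\<^sup>2 = (\<Sum>f\<in>B. (f \<bullet> R x)\<^sup>2)"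
    by (rule limit_statistic [OF pi1 pi2 rho', folded p_def, OF that])
  \<comment> \<open>The singular factor: \<open>adjoint K\<close> produces the limit of the centred
    counts before noise is added.\<close>
  obtain K :: "real^('r \<times> 'c) \<Rightarrow> real^('r \<times> 'c)" where
    K: "linear K" "\<And>s t. K s \<bullet> K t = (\<Sum>k\<in>UNIV. (p $ k + 0) * s $ k * t $ k) - (p \<bullet> s) * (p \<bullet> t)"
    by (rule covariance_factor [OF p order_refl]) blast
  \<comment> \<open>The random counts are replaced by the exact table n p, with all randomness moved
    into \<open>x\<close>.\<close>
  define F where "F n x = min_private_statistic d \<rho> n (real n *\<^sub>R p) (sqrt n *\<^sub>R x)" for n and x :: "real^('r \<times> 'c)"
  define F' where "F' x = (\<Sum>f\<in>B. (f \<bullet> R x)\<^sup>2)" for x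
  have F_tendsto: "(\<lambda>n. F n x) \<longlonglongrightarrow> F' x" for x
    unfolding F_def p_def using rho pi1 pi2 R inv [unfolded p_def] lower attained
    by (intro min_private_statistic_tendsto) (auto simp: F'_def)
  have F_measurable [measurable]: "F n \<in> borel_measurable borel" for n
    using measurable_compose [OF _ measurable_min_private_statistic [of d \<rho> n],
        of "\<lambda>x. (real n *\<^sub>R p, sqrt n *\<^sub>R x)" borel]
    by (simp add: F_def[abs_def] borel_prod [symmetric])
  have R_measurable [measurable]: "R \<in> borel_measurable borel"
    using R(1) by (intro borel_measurable_continuous_onI linear_continuous_on) (simp add: linear_conv_bounded_linear)
  have [measurable]: "adjoint K \<in> borel_measurable borel"
    using adjoint_linear [OF K(1)]
    by (intro borel_measurable_continuous_onI linear_continuous_on) (simp add: linear_conv_bounded_linear)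

  define W where "W n \<omega> = (1 / sqrt n) *\<^sub>R (contingency_table n (\<lambda>l. U n l \<omega>) (\<lambda>l. V n l \<omega>) - real n *\<^sub>R p)" for n \<omega>
  define \<nu> where "\<nu> n = distr (M n) borel (W n)" for n
  define \<nu>' where "\<nu>' = distr std_gaussian borel (adjoint K)"
  define \<mu> where "\<mu> = gaussian_smoothing \<sigma> \<nu>'"
  have W_measurable: "W n \<in> borel_measurable (M n)" if "n \<ge> 1" for n
  proof -
    have [measurable]: "U n l \<in> borel_measurable (M n)" "V n l \<in> borel_measurable (M n)" if "l \<in> {1..n}" for l
      using U_law [OF \<open>n \<ge> 1\<close> that] V_law [OF \<open>n \<ge> 1\<close> that] by (simp_all add: multinomial1_distributed_def)
    show ?thesis
      unfolding W_def contingency_table_eq_sum by measurable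
  qed
  have \<nu>: "prob_space (\<nu> n)" if "n \<ge> 1" for n
    unfolding \<nu>_def by (intro prob_space.prob_space_distr prob W_measurable that)
  have \<nu>': "prob_space \<nu>'"
    unfolding \<nu>'_def by (rule std_gaussian.prob_space_distr) simp
  have char_\<nu>': "(\<integral>w. cis (t \<bullet> w) \<partial>\<nu>') = of_real (exp (- ((\<Sum>k\<in>UNIV. p $ k * (t $ k)\<^sup>2) - (p \<bullet> t)\<^sup>2) / 2))" for t
    unfolding \<nu>'_def char_distr_std_gaussian [OF adjoint_linear [OF K(1)]] adjoint_adjoint [OF K(1)]
      power2_norm_eq_inner K(2)
    by (simp add: power2_eq_square mult.assoc)
  \<comment> \<open>Shifted by one because nothing is assumed about \<open>M 0\<close>.\<close>
  have char_tendsto: "(\<lambda>n. \<integral>w. cis (t \<bullet> w) \<partial>\<nu> (Suc n)) \<longlonglongrightarrow> (\<integral>w. cis (t \<bullet> w) \<partial>\<nu>')" for t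
  proof -
    define y where "y k = t $ k - t \<bullet> p" for k
    have char: "(\<integral>w. cis (t \<bullet> w) \<partial>\<nu> n) = (\<Sum>k\<in>UNIV. of_real (p $ k) * cis (y k / sqrt n)) ^ n" if n: "n \<ge> 1" for n
    proof -
      interpret prob_space "M n" using prob [OF n] .
      have "(\<integral>w. cis (t \<bullet> w) \<partial>\<nu> n) = (\<integral>\<omega>. cis (t \<bullet> W n \<omega>) \<partial>M n)"
        unfolding \<nu>_def using W_measurable [OF n] by (subst integral_distr) (auto simp: cis_conv_exp)
      then show ?thesis
        unfolding W_def p_def y_def
        using char_contingency_table [OF U_law [OF n] pi1 V_law [OF n] pi2 UV_indep [OF n] pairs_indep [OF n] n] by simp
    qed
    define m where "m = p \<bullet> t"
    have m: "(\<Sum>k\<in>UNIV. p $ k * t $ k) = m"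
      by (simp add: m_def inner_vec_def)
    have y: "y k = t $ k - m" for k
      by (simp add: y_def m_def inner_commute)
    have "(\<Sum>k\<in>UNIV. p $ k * y k) = (\<Sum>k\<in>UNIV. p $ k * t $ k) - (\<Sum>k\<in>UNIV. p $ k) * m"
      by (simp only: y right_diff_distrib sum_subtractf sum_distrib_right)
    then have mean: "(\<Sum>k\<in>UNIV. p $ k * y k) = 0"
      by (simp add: m sum_p)
    have "p $ k * (y k)\<^sup>2 = p $ k * (t $ k)\<^sup>2 - 2 * m * (p $ k * t $ k) + m\<^sup>2 * p $ k" for k
      unfolding y by algebra
    then have "(\<Sum>k\<in>UNIV. p $ k * (y k)\<^sup>2) = (\<Sum>k\<in>UNIV. p $ k * (t $ k)\<^sup>2) -
        2 * m * (\<Sum>k\<in>UNIV. p $ k * t $ k) + m\<^sup>2 * (\<Sum>k\<in>UNIV. p $ k)"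
      by (simp only: sum.distrib sum_subtractf sum_distrib_left)
    then have var: "(\<Sum>k\<in>UNIV. p $ k * (y k)\<^sup>2) = (\<Sum>k\<in>UNIV. p $ k * (t $ k)\<^sup>2) - (p \<bullet> t)\<^sup>2"
      unfolding m sum_p by (simp add: m_def power2_eq_square)
    have "(\<lambda>n. (\<Sum>k\<in>UNIV. of_real (p $ k) * cis (y k / sqrt (real n))) ^ n) \<longlonglongrightarrow> (\<integral>w. cis (t \<bullet> w) \<partial>\<nu>')"
      unfolding char_\<nu>' var [symmetric] using p_nonneg sum_p mean by (rule char_power_tendsto)
    then have "(\<lambda>n. (\<Sum>k\<in>UNIV. of_real (p $ k) * cis (y k / sqrt (real (Suc n)))) ^ Suc n) \<longlonglongrightarrow> (\<integral>w. cis (t \<bullet> w) \<partial>\<nu>')"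
      by (rule LIMSEQ_Suc)
    then show ?thesis
      by (simp add: char)
  qed

  have law_R: "distr \<mu> borel R = std_gaussian"
  proof (rule char_determines_measure)
    interpret \<mu>: prob_space \<mu>
      unfolding \<mu>_def by (rule prob_space_gaussian_smoothing [OF \<nu>']) (simp add: \<nu>'_def)
    have sets_\<mu>[measurable_cong]: "sets \<mu> = sets borel"
      by (simp add: \<mu>_def gaussian_smoothing_def)
    show "prob_space (distr \<mu> borel R)"
      by (rule \<mu>.prob_space_distr) measurable
    fix t
    define s where "s = adjoint R t"
    \<comment> \<open>The independent noise adds its variance 1 / \<rho> to the diagonal of the
      multinomial form, which is precisely the form factored by \<open>A\<close>.\<close>
    have "(norm (A s))\<^sup>2 = (\<Sum>k\<in>UNIV. p $ k * (s $ k)\<^sup>2) - (p \<bullet> s)\<^sup>2 + (\<sigma> * norm s)\<^sup>2"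
      unfolding power_mult_distrib \<sigma>(2) power2_norm_eq_inner A2
      by (simp add: inner_vec_def [of s s] algebra_simps power2_eq_square sum.distrib sum_distrib_left add_divide_distrib sum_divide_distrib)
    then have norm_t: "(norm t)\<^sup>2 = (\<Sum>k\<in>UNIV. p $ k * (s $ k)\<^sup>2) - (p \<bullet> s)\<^sup>2 + (\<sigma> * norm s)\<^sup>2"
      by (simp add: s_def AR)
    have "(\<integral>w. cis (t \<bullet> w) \<partial>distr \<mu> borel R) = (\<integral>x. cis (s \<bullet> x) \<partial>\<mu>)"
      by (subst integral_distr) (auto simp: cis_conv_exp s_def adjoint_works [OF R(1)] inner_commute)
    also have "\<dots> = (\<integral>w. cis (s \<bullet> w) \<partial>\<nu>') * of_real (exp (- (\<sigma> * norm s)\<^sup>2 / 2))"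
      unfolding \<mu>_def by (rule char_gaussian_smoothing [OF \<nu>']) (simp add: \<nu>'_def)
    also have "\<dots> = of_real (exp (- (norm t)\<^sup>2 / 2))"
      unfolding char_\<nu>' norm_t of_real_mult [symmetric] exp_add [symmetric] by (simp add: field_simps)
    finally show "(\<integral>w. cis (t \<bullet> w) \<partial>distr \<mu> borel R) = (\<integral>w. cis (t \<bullet> w) \<partial>std_gaussian)"
      by (simp only: char_std_gaussian)
  qed (simp_all add: std_gaussian.prob_space_axioms)
  have law_F': "distr \<mu> borel F' = chi_square_distribution ((CARD('r) - 1) * (CARD('c) - 1))"
  proof -
    have [measurable_cong]: "sets \<mu> = sets borel"
      by (simp add: \<mu>_def gaussian_smoothing_def)
    have "distr \<mu> borel F' = distr (distr \<mu> borel R) borel (\<lambda>g. \<Sum>f\<in>B. (f \<bullet> g)\<^sup>2)"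
      by (subst distr_distr) (auto simp: o_def F'_def[abs_def])
    then show ?thesis
      unfolding law_R using distr_std_gaussian_sum_orthonormal [OF B(1-3)] B(4) by simp
  qed

  have cdf_eq: "cdf (distr (M n) borel (\<lambda>\<omega>. min_private_statistic d \<rho> n
        (contingency_table n (\<lambda>l. U n l \<omega>) (\<lambda>l. V n l \<omega>)) (Z n \<omega>))) c =
      measure (gaussian_smoothing \<sigma> (\<nu> n)) {x. F n x \<le> c}" if n: "n \<ge> 1" for n c
  proof -
    interpret prob_space "M n" using prob [OF n] .
    define s where "s = sqrt (real n / \<rho>)"
    have s: "s > 0" "s\<^sup>2 = real n / \<rho>" "s = sqrt n * \<sigma>"
      using n rho by (simp_all add: s_def \<sigma>_def real_sqrt_divide power_divide)
    define H where "H \<omega> = contingency_table n (\<lambda>l. U n l \<omega>) (\<lambda>l. V n l \<omega>)" for \<omega>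
    define pairs where "pairs \<omega> = (\<lambda>l\<in>{1..n}. (U n l \<omega>, V n l \<omega>))" for \<omega>
    \<comment> \<open>Expresses the normalised counts through the whole tuple of observations, the
      variable from which the noise is independent.\<close>
    define w where "w f = (1 / sqrt n) *\<^sub>R ((\<Sum>l=1..n. cell_indicator (fst (f l)) (snd (f l))) - real n *\<^sub>R p)"
      for f :: "nat \<Rightarrow> (real^'r) \<times> (real^'c)"
    have [measurable]: "U n l \<in> borel_measurable (M n)" "V n l \<in> borel_measurable (M n)" if "l \<in> {1..n}" for l
      using U_law [OF n that] V_law [OF n that] by (simp_all add: multinomial1_distributed_def)
    have [measurable]: "H \<in> borel_measurable (M n)"
      unfolding H_def contingency_table_eq_sum by measurable
    have [measurable]: "Z n \<in> borel_measurable (M n)"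
      using Z_law [OF n] by (simp add: distributed_def)
    have w_measurable: "w \<in> borel_measurable (\<Pi>\<^sub>M l\<in>{1..n}. borel)"
    proof -
      have "(\<lambda>f. cell_indicator (fst (f l)) (snd (f l))) \<in> borel_measurable (\<Pi>\<^sub>M l\<in>{1..n}. (borel :: ((real^'r) \<times> (real^'c)) measure))"
        if "l \<in> {1..n}" for l
        using measurable_compose [OF measurable_component_singleton [OF that, of "\<lambda>_. borel"] measurable_cell_indicator [unfolded borel_prod]]
        by (simp add: split_beta')
      then show ?thesis
        unfolding w_def by measurable
    qed
    have W_eq: "W n \<omega> = w (pairs \<omega>)" for \<omega>
      by (simp add: W_def w_def pairs_def contingency_table_eq_sum)
    have "distr (M n) (borel \<Otimes>\<^sub>M borel) (\<lambda>\<omega>. (W n \<omega>, (1 / s) *\<^sub>R Z n \<omega>)) =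
        distr (M n) borel (\<lambda>\<omega>. W n \<omega>) \<Otimes>\<^sub>M distr (M n) borel (\<lambda>\<omega>. (1 / s) *\<^sub>R Z n \<omega>)"
      unfolding W_eq pairs_def
      by (rule distr_pair_independent_rvs [OF Z_indep [OF n] _ w_measurable]) simp
    also have "\<dots> = \<nu> n \<Otimes>\<^sub>M std_gaussian"
      using distr_multivariate_normal_rescaled [OF s(1), of "M n" "Z n"] Z_law [OF n] by (simp add: s(2) \<nu>_def)
    finally have joint: "distr (M n) (borel \<Otimes>\<^sub>M borel) (\<lambda>\<omega>. (W n \<omega>, (1 / s) *\<^sub>R Z n \<omega>)) = \<nu> n \<Otimes>\<^sub>M std_gaussian" .
    define X where "X \<omega> = W n \<omega> + (1 / sqrt n) *\<^sub>R Z n \<omega>" for \<omega>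
    have X_measurable [measurable]: "X \<in> borel_measurable (M n)"
      unfolding X_def using W_measurable [OF n] by measurable
    have law_X: "distr (M n) borel X = gaussian_smoothing \<sigma> (\<nu> n)"
    proof -
      have "gaussian_smoothing \<sigma> (\<nu> n) = distr (M n) borel (\<lambda>\<omega>. W n \<omega> + \<sigma> *\<^sub>R (1 / s) *\<^sub>R Z n \<omega>)"
        unfolding gaussian_smoothing_def joint [symmetric]
        using W_measurable [OF n] by (subst distr_distr) (auto simp: o_def)
      also have "(\<lambda>\<omega>. W n \<omega> + \<sigma> *\<^sub>R (1 / s) *\<^sub>R Z n \<omega>) = X"
        using \<sigma>(1) by (auto simp: X_def s(3))
      finally show ?thesis ..
    qed
    \<comment> \<open>This holds only almost surely: off the prescribed atoms an observation may
      mark no cell or several.\<close>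
    have total: "AE \<omega> in M n. (\<Sum>k\<in>UNIV. H \<omega> $ k) = real n"
    proof -
      have "AE \<omega> in M n. \<forall>l\<in>{1..n}. \<exists>k. cell_indicator (U n l \<omega>) (V n l \<omega>) = axis k 1"
      proof (intro AE_finite_allI)
        fix l assume l: "l \<in> {1..n}"
        show "AE \<omega> in M n. \<exists>k. cell_indicator (U n l \<omega>) (V n l \<omega>) = axis k 1"
          using multinomial1_AE [OF U_law [OF n l] pi1] multinomial1_AE [OF V_law [OF n l] pi2]
          by eventually_elim (metis cell_indicator_axis)
      qed simp
      then show ?thesis
      proof eventually_elim
        case (elim \<omega>)
        have "1 \<bullet> cell_indicator (U n l \<omega>) (V n l \<omega>) = 1" if l: "l \<in> {1..n}" for l
        proof -
          obtain k where "cell_indicator (U n l \<omega>) (V n l \<omega>) = axis k 1"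
            using elim l by blast
          then show ?thesis by (simp add: inner_axis)
        qed
        then have "1 \<bullet> H \<omega> = real n"
          by (simp add: H_def contingency_table_eq_sum inner_sum_right)
        then show ?case
          by (simp add: inner_1_eq_sum)
      qed
    qed
    have stat_eq: "min_private_statistic d \<rho> n (H \<omega>) (Z n \<omega>) = F n (X \<omega>)" if "(\<Sum>k\<in>UNIV. H \<omega> $ k) = real n" for \<omega>
    proof -
      have "sqrt n *\<^sub>R X \<omega> = H \<omega> - real n *\<^sub>R p + Z n \<omega>"
        using n by (simp add: X_def W_def H_def scaleR_add_right)
      then show ?thesis
        unfolding F_def using that sum_p
        by (intro min_private_statistic_cong)
           (simp_all add: noisy_size_def sum.distrib sum_subtractf flip: sum_distrib_left)
    qed
    have stat_measurable [measurable]: "(\<lambda>\<omega>. min_private_statistic d \<rho> n (H \<omega>) (Z n \<omega>)) \<in> borel_measurable (M n)"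
      using measurable_compose [OF _ measurable_min_private_statistic [of d \<rho> n], of "\<lambda>\<omega>. (H \<omega>, Z n \<omega>)" "M n"]
      by (simp add: borel_prod [symmetric])
    have "cdf (distr (M n) borel (\<lambda>\<omega>. min_private_statistic d \<rho> n (H \<omega>) (Z n \<omega>))) c =
        prob {\<omega> \<in> space (M n). min_private_statistic d \<rho> n (H \<omega>) (Z n \<omega>) \<le> c}"
      by (simp add: cdf_def measure_distr vimage_def Int_def conj_commute)
    also have "\<dots> = prob {\<omega> \<in> space (M n). F n (X \<omega>) \<le> c}"
      by (rule finite_measure_eq_AE) (use total in \<open>eventually_elim, simp add: stat_eq\<close>, measurable)
    also have "\<dots> = measure (distr (M n) borel X) {x. F n x \<le> c}"
      by (subst measure_distr) (auto intro!: arg_cong2 [where f = measure])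
    finally show ?thesis
      by (simp add: law_X H_def)
  qed

  show ?thesis
    unfolding weak_conv_m_def weak_conv_def law_F' [symmetric]
  proof (intro allI impI)
    fix c assume cont: "isCont (cdf (distr \<mu> borel F')) c"
    let ?T = "\<lambda>n. cdf (distr (M n) borel (\<lambda>\<omega>. min_private_statistic d \<rho> n
        (contingency_table n (\<lambda>l. U n l \<omega>) (\<lambda>l. V n l \<omega>)) (Z n \<omega>))) c"
    have T: "?T (Suc n) = measure (gaussian_smoothing \<sigma> (\<nu> (Suc n))) {x. F (Suc n) x \<le> c}" for n
      by (rule cdf_eq) simp
    have \<mu>: "prob_space \<mu>"
      unfolding \<mu>_def by (rule prob_space_gaussian_smoothing [OF \<nu>']) (simp add: \<nu>'_def)
    have sets_\<mu>[measurable_cong]: "sets \<mu> = sets borel"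
      by (simp add: \<mu>_def gaussian_smoothing_def)
    \<comment> \<open>The sublevel sets depend on n on both sides; after this replacement only the
      fixed law \<mu> remains.\<close>
    have "(\<lambda>n. measure (gaussian_smoothing \<sigma> (\<nu> (Suc n))) {x. F (Suc n) x \<le> c} - measure \<mu> {x. F (Suc n) x \<le> c}) \<longlonglongrightarrow> 0"
      unfolding \<mu>_def
      by (rule gaussian_smoothing_tendsto [OF \<sigma>(1) \<nu> _ \<nu>' _ char_tendsto]) (simp_all add: \<nu>_def \<nu>'_def)
    moreover have "(\<lambda>n. measure \<mu> {x. F (Suc n) x \<le> c}) \<longlonglongrightarrow> cdf (distr \<mu> borel F') c"
    proof -
      have "F' \<in> borel_measurable borel"
        unfolding F'_def[abs_def] by measurable
      then have "F' \<in> borel_measurable \<mu>" "F (Suc n) \<in> borel_measurable \<mu>" for n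
        using F_measurable measurable_cong_sets [OF sets_\<mu> refl] by blast+
      then have "(\<lambda>n. measure \<mu> {x \<in> space \<mu>. F (Suc n) x \<le> c}) \<longlonglongrightarrow> cdf (distr \<mu> borel F') c"
        using \<mu> LIMSEQ_Suc [OF F_tendsto] cont by (intro cdf_tendsto_of_pointwise)
      moreover have "space \<mu> = UNIV"
        using sets_eq_imp_space_eq [OF sets_\<mu>] by simp
      ultimately show ?thesis by simp
    qed
    ultimately have "(\<lambda>n. measure (gaussian_smoothing \<sigma> (\<nu> (Suc n))) {x. F (Suc n) x \<le> c} - measure \<mu> {x. F (Suc n) x \<le> c}
        + measure \<mu> {x. F (Suc n) x \<le> c}) \<longlonglongrightarrow> 0 + cdf (distr \<mu> borel F') c"
      by (rule tendsto_add)
    then have "(\<lambda>n. ?T (Suc n)) \<longlonglongrightarrow> cdf (distr \<mu> borel F') c"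
      by (simp only: T diff_add_cancel add_0_left)
    then show "?T \<longlonglongrightarrow> cdf (distr \<mu> borel F') c"
      by (rule LIMSEQ_imp_Suc)
  qed
qed

end
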